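(* Let $(M,\omega)$ be the $4$-dimensional compact symplectic manifold constructed in the context and let $\Delta\subset\mathbb{R}^2$ be the octagon with vertices $(0,2),(0,1),(1,0),(2,0),(3,1),(3,2),(2,3),(1,3)$. Then $F=(J,H):(M,\omega)\to\mathbb{R}^2$ with $$J([z_1,\ldots,z_8])=\tfrac12|z_1|^2,\qquad H([z_1,\ldots,z_8])=\tfrac12|z_3|^2$$ is a momentum map of an effective Hamiltonian $2$-torus action and satisfies $F(M)=\Delta$. The $\mathbb{S}^1$-action of $J$ is given by $$\mathbb{S}^1\times M\to M,\qquad (t,[z_1,\ldots,z_8])\mapsto[e^{-it}z_1,z_2,\ldots,z_8]$$ and the $\mathbb{S}^1$-action of $H$ by $$\mathbb{S}^1\times M\to M,\qquad (t,[z_1,\ldots,z_8])\mapsto[z_1,z_2,e^{-it}z_3,z_4,\ldots,z_8].$$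
   Context: Construction of $(M,\omega)$. On $\mathbb{C}^8$ with coordinates $z_k=x_k+iy_k$ take the symplectic form $\omega_{st}=\sum_{k=1}^8 dx_k\wedge dy_k=\frac{i}{2}\sum_{k=1}^8 dz_k\wedge d\bar z_k$. Let $W\subset\mathbb{C}^8$ be the set of points satisfying (A) $|z_1|^2+|z_5|^2=6$, (B) $|z_2|^2+|z_5|^2+|z_7|^2=10$, (C) $|z_3|^2+|z_7|^2=6$, (D) $|z_4|^2-|z_5|^2+|z_7|^2=4$, (E) $|z_5|^2-|z_6|^2+|z_7|^2=2$, (F) $|z_5|^2-|z_7|^2+|z_8|^2=4$. The torus $N\simeq\mathbb{T}^6=(\mathbb{R}/2\pi\mathbb{Z})^6$ acts on $\mathbb{C}^8$ by $$(t,z)\mapsto(e^{it_1}z_1,e^{it_2}z_2,e^{it_3}z_3,e^{it_4}z_4,e^{i(t_1+t_2-t_4-t_5+t_6)}z_5,e^{it_5}z_6,e^{i(t_2+t_3+t_4-t_5-t_6)}z_7,e^{it_6}z_8).$$ $W$ is a regular level set of a momentum map of this action, $N$ acts freely on $W$, and $M:=W/N$ with quotient map $\tau:W\to M$ carries the unique symplectic form $\omega$ with $\tau^*\omega=\kappa^*\omega_{st}$, where $\kappa:W\hookrightarrow\mathbb{C}^8$ is the inclusion. Points of $M$ are written $[z]=[z_1,\dots,z_8]$. The Hamiltonian vector field of $f$ is defined by $\omega(\mathcal{X}^f,\cdot)=df$; $\mathbb{S}^1=\mathbb{R}/2\pi\mathbb{Z}$; the $\mathbb{S}^1$-action of $J$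 (resp. $H$) is the ($2\pi$-periodic) flow of $\mathcal{X}^J$ (resp. $\mathcal{X}^H$). *)

theory Defs
  imports "HOL-Analysis.Analysis"
begin

section \<open>Smooth maps between subsets of Euclidean spaces\<close>

text \<open>
  On an open set, the continuous maps whose directional derivatives exist and are continuous up
  to order \<open>n\<close>.
\<close>

primrec Ck_on :: "nat \<Rightarrow> 'a::euclidean_space set \<Rightarrow> ('a \<Rightarrow> 'b::euclidean_space) \<Rightarrow> bool" where
  "Ck_on 0 S f \<longleftrightarrow> continuous_on S f"
| "Ck_on (Suc n) S f \<longleftrightarrow>
     (\<forall>x\<in>S. f differentiable (at x)) \<and> (\<forall>v. Ck_on n S (\<lambda>x. frechet_derivative f (at x) v))"

text \<open>
  Smoothness on an arbitrary subset is local extendability to a smooth map on an open set. On an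
  open set this is the usual notion, on an embedded submanifold it is smoothness for the
  submanifold structure.
\<close>

definition smooth_on :: "'a::euclidean_space set \<Rightarrow> ('a \<Rightarrow> 'b::euclidean_space) \<Rightarrow> bool" where
  "smooth_on S f \<longleftrightarrow>
     (\<forall>x\<in>S. \<exists>U g. open U \<and> x \<in> U \<and> (\<forall>n. Ck_on n U g) \<and> (\<forall>y\<in>S \<inter> U. g y = f y))"

section \<open>Smooth manifolds\<close>

text \<open>
  A chart is a pair of a domain and a map into the model space \<open>'e\<close>; the value of the map
  outside the domain is irrelevant. The dimension is \<open>DIM('e)\<close>.
\<close>

type_synonym ('m, 'e) chart = "'m set \<times> ('m \<Rightarrow> 'e)"
type_synonym ('m, 'e) atlas = "('m, 'e) chart set"

definition atlas_carrier :: "('m, 'e) atlas \<Rightarrow> 'm set" where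
  "atlas_carrier A = \<Union> (fst ` A)"

definition smooth_manifold :: "'m topology \<Rightarrow> ('m, 'e::euclidean_space) atlas \<Rightarrow> bool" where
  "smooth_manifold X A \<longleftrightarrow>
     Hausdorff_space X \<and> second_countable X \<and> atlas_carrier A = topspace X \<and>
     (\<forall>(U, \<phi>)\<in>A. openin X U \<and> open (\<phi> ` U) \<and>
        homeomorphic_map (subtopology X U) (top_of_set (\<phi> ` U)) \<phi>) \<and>
     (\<forall>(U, \<phi>)\<in>A. \<forall>(V, \<psi>)\<in>A. smooth_on (\<phi> ` (U \<inter> V)) (\<psi> \<circ> inv_into U \<phi>))"

definition euclidean_atlas :: "'e::euclidean_space set \<Rightarrow> ('e, 'e) atlas" where
  "euclidean_atlas S = {(S, id)}"

definition prod_atlas :: "('m, 'e) atlas \<Rightarrow> ('n, 'f) atlas \<Rightarrow> ('m \<times> 'n, 'e \<times> 'f) atlas" where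
  "prod_atlas A B = {(U \<times> V, map_prod \<phi> \<psi>) | U \<phi> V \<psi>. (U, \<phi>) \<in> A \<and> (V, \<psi>) \<in> B}"

definition smooth_map ::
  "('m, 'e::euclidean_space) atlas \<Rightarrow> ('n, 'f::euclidean_space) atlas \<Rightarrow> ('m \<Rightarrow> 'n) \<Rightarrow> bool" where
  "smooth_map A B f \<longleftrightarrow>
     (\<forall>p\<in>atlas_carrier A. \<exists>(U, \<phi>)\<in>A. \<exists>(V, \<psi>)\<in>B. \<exists>D. p \<in> U \<and>
        open D \<and> \<phi> p \<in> D \<and> D \<subseteq> \<phi> ` U \<and> (\<forall>x\<in>D. f (inv_into U \<phi> x) \<in> V) \<and>
        smooth_on D (\<lambda>x. \<psi> (f (inv_into U \<phi> x))))"

definition smooth_functions :: "('m, 'e::euclidean_space) atlas \<Rightarrow> ('m \<Rightarrow> real) set" where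
  "smooth_functions A = {f. smooth_map A (euclidean_atlas UNIV) f}"

section \<open>Tangent vectors and two-forms\<close>

text \<open>
  A tangent vector is the operator ``derivative along a smooth curve'' on smooth functions. It is
  set to zero on functions that are not smooth, so that equal tangent vectors are equal operators.
  The differential of a function \<open>f\<close> at a tangent vector \<open>X\<close> is \<open>X f\<close>.
\<close>

type_synonym 'm tangent = "('m \<Rightarrow> real) \<Rightarrow> real"
type_synonym 'm two_form = "'m \<Rightarrow> 'm tangent \<Rightarrow> 'm tangent \<Rightarrow> real"

definition velocity :: "('m, 'e::euclidean_space) atlas \<Rightarrow> (real \<Rightarrow> 'm) \<Rightarrow> 'm tangent" where
  "velocity A c = (\<lambda>f. if f \<in> smooth_functions A then deriv (\<lambda>t. f (c t)) 0 else 0)"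

definition smooth_curve :: "('m, 'e::euclidean_space) atlas \<Rightarrow> (real \<Rightarrow> 'm) \<Rightarrow> bool" where
  "smooth_curve A c \<longleftrightarrow> (\<exists>e>0. smooth_map (euclidean_atlas {-e<..<e}) A c)"

definition tangent_space :: "('m, 'e::euclidean_space) atlas \<Rightarrow> 'm \<Rightarrow> 'm tangent set" where
  "tangent_space A p = {velocity A c | c. smooth_curve A c \<and> c 0 = p}"

definition pushforward ::
  "('m, 'e::euclidean_space) atlas \<Rightarrow> ('n, 'f::euclidean_space) atlas \<Rightarrow> ('m \<Rightarrow> 'n) \<Rightarrow>
   'm tangent \<Rightarrow> 'n tangent" where
  "pushforward A B g X = (\<lambda>f. if f \<in> smooth_functions B then X (f \<circ> g) else 0)"

text \<open>
  The coefficient of \<open>\<omega>\<close> in a chart: its value on the constant coordinate vector fields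
  \<open>a\<close> and \<open>b\<close>.
\<close>

definition coord_vector ::
  "('m, 'e::euclidean_space) atlas \<Rightarrow> ('m, 'e) chart \<Rightarrow> 'e \<Rightarrow> 'e \<Rightarrow> 'm tangent" where
  "coord_vector A = (\<lambda>(U, \<phi>) a x. velocity A (\<lambda>t. inv_into U \<phi> (x + t *\<^sub>R a)))"

definition coord_form ::
  "('m, 'e::euclidean_space) atlas \<Rightarrow> 'm two_form \<Rightarrow> ('m, 'e) chart \<Rightarrow> 'e \<Rightarrow> 'e \<Rightarrow> 'e \<Rightarrow> real" where
  "coord_form A \<omega> C a b x =
     \<omega> (inv_into (fst C) (snd C) x) (coord_vector A C a x) (coord_vector A C b x)"

definition smooth_two_form :: "('m, 'e::euclidean_space) atlas \<Rightarrow> 'm two_form \<Rightarrow> bool" where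
  "smooth_two_form A \<omega> \<longleftrightarrow>
     (\<forall>p\<in>atlas_carrier A. \<forall>X\<in>tangent_space A p. \<forall>Y\<in>tangent_space A p.
        \<omega> p X Y = - \<omega> p Y X \<and>
        (\<forall>Z\<in>tangent_space A p. \<forall>a b. \<omega> p (\<lambda>f. a * X f + b * Y f) Z = a * \<omega> p X Z + b * \<omega> p Y Z)) \<and>
     (\<forall>C\<in>A. \<forall>a b. smooth_on (snd C ` fst C) (coord_form A \<omega> C a b))"

text \<open>
  Closedness is \<open>d\<omega>(a, b, c) = 0\<close> for constant coordinate fields \<open>a\<close>, \<open>b\<close>, \<open>c\<close>; since these
  commute, only the cyclic sum of derivatives of coefficients remains.
\<close>

definition closed_two_form :: "('m, 'e::euclidean_space) atlas \<Rightarrow> 'm two_form \<Rightarrow> bool" where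
  "closed_two_form A \<omega> \<longleftrightarrow>
     (\<forall>C\<in>A. \<forall>x\<in>snd C ` fst C. \<forall>a b c.
        frechet_derivative (coord_form A \<omega> C b c) (at x) a +
        frechet_derivative (coord_form A \<omega> C c a) (at x) b +
        frechet_derivative (coord_form A \<omega> C a b) (at x) c = 0)"

definition nondegenerate :: "('m, 'e::euclidean_space) atlas \<Rightarrow> 'm two_form \<Rightarrow> bool" where
  "nondegenerate A \<omega> \<longleftrightarrow>
     (\<forall>p\<in>atlas_carrier A. \<forall>X\<in>tangent_space A p.
        (\<forall>Y\<in>tangent_space A p. \<omega> p X Y = 0) \<longrightarrow> X = (\<lambda>_. 0))"

definition symplectic_manifold ::
  "'m topology \<Rightarrow> ('m, 'e::euclidean_space) atlas \<Rightarrow> 'm two_form \<Rightarrow> bool" where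
  "symplectic_manifold X A \<omega> \<longleftrightarrow>
     smooth_manifold X A \<and> smooth_two_form A \<omega> \<and> closed_two_form A \<omega> \<and> nondegenerate A \<omega>"

text \<open>The vector field \<open>\<X>\<^sup>f\<close> with \<open>\<omega>(\<X>\<^sup>f, \<cdot>) = df\<close>.\<close>

definition hamiltonian_vector_field ::
  "('m, 'e::euclidean_space) atlas \<Rightarrow> 'm two_form \<Rightarrow> ('m \<Rightarrow> real) \<Rightarrow> 'm \<Rightarrow> 'm tangent" where
  "hamiltonian_vector_field A \<omega> f p =
     (THE X. X \<in> tangent_space A p \<and> (\<forall>Y\<in>tangent_space A p. \<omega> p X Y = Y f))"

section \<open>Torus actions and momentum maps\<close>

text \<open>
  The torus is \<open>'t / 2\<pi>\<Lambda>\<close>, where \<open>\<Lambda>\<close> is the integer span of the standard basis of \<open>'t\<close>: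
  \<open>real ^ 'n\<close> gives the \<open>n\<close>-torus and \<open>real\<close> the circle. Its smooth actions are the smooth
  actions of \<open>'t\<close> for which the generators of \<open>2\<pi>\<Lambda>\<close> act trivially.
\<close>

definition torus_action ::
  "('m, 'e::euclidean_space) atlas \<Rightarrow> ('t::euclidean_space \<Rightarrow> 'm \<Rightarrow> 'm) \<Rightarrow> bool" where
  "torus_action A \<rho> \<longleftrightarrow>
     smooth_map (prod_atlas (euclidean_atlas UNIV) A) A (\<lambda>(t, p). \<rho> t p) \<and>
     (\<forall>p\<in>atlas_carrier A. \<rho> 0 p = p \<and> (\<forall>s t. \<rho> (s + t) p = \<rho> s (\<rho> t p)) \<and>
        (\<forall>b\<in>Basis. \<rho> ((2 * pi) *\<^sub>R b) p = p))"

text \<open>Only the neutral element of the torus acts trivially.\<close>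

definition effective ::
  "('m, 'e::euclidean_space) atlas \<Rightarrow> ('t::euclidean_space \<Rightarrow> 'm \<Rightarrow> 'm) \<Rightarrow> bool" where
  "effective A \<rho> \<longleftrightarrow>
     (\<forall>t. (\<forall>p\<in>atlas_carrier A. \<rho> t p = p) \<longrightarrow> (\<forall>b\<in>Basis. \<exists>m::int. t \<bullet> b = 2 * pi * of_int m))"

definition symplectic_action ::
  "('m, 'e::euclidean_space) atlas \<Rightarrow> 'm two_form \<Rightarrow> ('t \<Rightarrow> 'm \<Rightarrow> 'm) \<Rightarrow> bool" where
  "symplectic_action A \<omega> \<rho> \<longleftrightarrow>
     (\<forall>t. \<forall>p\<in>atlas_carrier A. \<forall>X\<in>tangent_space A p. \<forall>Y\<in>tangent_space A p.
        \<omega> (\<rho> t p) (pushforward A A (\<rho> t) X) (pushforward A A (\<rho> t) Y) = \<omega> p X Y)"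

text \<open>
  The Lie algebra of the torus is \<open>'t\<close>, identified with its dual by the inner product. The
  second condition says that the fundamental vector field of \<open>\<xi>\<close> is the Hamiltonian vector field
  of \<open>\<xi> \<bullet> F\<close>; equivariance is invariance, the coadjoint action of a torus being trivial.
\<close>

definition momentum_map ::
  "('m, 'e::euclidean_space) atlas \<Rightarrow> 'm two_form \<Rightarrow> ('t::euclidean_space \<Rightarrow> 'm \<Rightarrow> 'm) \<Rightarrow>
   ('m \<Rightarrow> 't) \<Rightarrow> bool" where
  "momentum_map A \<omega> \<rho> F \<longleftrightarrow>
     smooth_map A (euclidean_atlas UNIV) F \<and>
     (\<forall>p\<in>atlas_carrier A. \<forall>\<xi>.
        velocity A (\<lambda>s. \<rho> (s *\<^sub>R \<xi>) p) \<in> tangent_space A p \<and>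
        (\<forall>Y\<in>tangent_space A p. \<omega> p (velocity A (\<lambda>s. \<rho> (s *\<^sub>R \<xi>) p)) Y = Y (\<lambda>q. \<xi> \<bullet> F q))) \<and>
     (\<forall>t. \<forall>p\<in>atlas_carrier A. F (\<rho> t p) = F p)"

definition hamiltonian_torus_action ::
  "('m, 'e::euclidean_space) atlas \<Rightarrow> 'm two_form \<Rightarrow> ('t::euclidean_space \<Rightarrow> 'm \<Rightarrow> 'm) \<Rightarrow>
   ('m \<Rightarrow> 't) \<Rightarrow> bool" where
  "hamiltonian_torus_action A \<omega> \<rho> F \<longleftrightarrow>
     torus_action A \<rho> \<and> symplectic_action A \<omega> \<rho> \<and> momentum_map A \<omega> \<rho> F"

text \<open>\<open>\<rho>\<close> is a circle action which is the flow of the Hamiltonian vector field of \<open>f\<close>.\<close>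

definition circle_action_of ::
  "('m, 'e::euclidean_space) atlas \<Rightarrow> 'm two_form \<Rightarrow> ('m \<Rightarrow> real) \<Rightarrow> (real \<Rightarrow> 'm \<Rightarrow> 'm) \<Rightarrow> bool" where
  "circle_action_of A \<omega> f \<rho> \<longleftrightarrow>
     torus_action A \<rho> \<and>
     (\<forall>p\<in>atlas_carrier A. \<forall>t.
        velocity A (\<lambda>s. \<rho> (t + s) p) = hamiltonian_vector_field A \<omega> f (\<rho> t p))"

section \<open>Quotients of submanifolds of Euclidean space\<close>

definition quotient_topology :: "'a::topological_space set \<Rightarrow> ('a \<Rightarrow> 'm) \<Rightarrow> 'm topology" where
  "quotient_topology S \<pi> =
     topology (\<lambda>U. U \<subseteq> \<pi> ` S \<and> openin (top_of_set S) {z \<in> S. \<pi> z \<in> U})"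

lemma openin_quotient_topology:
  "openin (quotient_topology S \<pi>) U \<longleftrightarrow>
     U \<subseteq> \<pi> ` S \<and> openin (top_of_set S) {z \<in> S. \<pi> z \<in> U}"
proof -
  let ?P = "\<lambda>U. U \<subseteq> \<pi> ` S \<and> openin (top_of_set S) {z \<in> S. \<pi> z \<in> U}"
  have "istopology ?P"
    unfolding istopology_def
  proof (intro conjI allI impI)
    fix U V assume "?P U" "?P V"
    moreover have "{z \<in> S. \<pi> z \<in> U \<inter> V} = {z \<in> S. \<pi> z \<in> U} \<inter> {z \<in> S. \<pi> z \<in> V}" by auto
    ultimately show "U \<inter> V \<subseteq> \<pi> ` S" "openin (top_of_set S) {z \<in> S. \<pi> z \<in> U \<inter> V}"
      by (auto intro: openin_Int)
  next
    fix \<U> assume *: "\<forall>U\<in>\<U>. ?P U"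
    moreover have "{z \<in> S. \<pi> z \<in> \<Union> \<U>} = \<Union> ((\<lambda>U. {z \<in> S. \<pi> z \<in> U}) ` \<U>)" by auto
    ultimately show "\<Union> \<U> \<subseteq> \<pi> ` S" "openin (top_of_set S) {z \<in> S. \<pi> z \<in> \<Union> \<U>}"
      by (auto intro!: openin_Union)
  qed
  then show ?thesis
    unfolding quotient_topology_def by (simp add: topology_inverse')
qed

text \<open>
  \<open>\<pi>\<close>, defined on the submanifold \<open>S\<close>, is smooth, and every point of \<open>S\<close> lies on a smooth local
  section of \<open>\<pi>\<close>; that is, \<open>\<pi>\<close> is a smooth submersion. For surjective \<open>\<pi>\<close> this
  determines the smooth structure of the target.
\<close>

definition smooth_submersion ::
  "'a::euclidean_space set \<Rightarrow> ('m, 'e::euclidean_space) atlas \<Rightarrow> ('a \<Rightarrow> 'm) \<Rightarrow> bool" where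
  "smooth_submersion S A \<pi> \<longleftrightarrow>
     (\<forall>(U, \<phi>)\<in>A. smooth_on {z \<in> S. \<pi> z \<in> U} (\<phi> \<circ> \<pi>)) \<and>
     (\<forall>z\<in>S. \<exists>(U, \<phi>)\<in>A. \<exists>D \<sigma>. \<pi> z \<in> U \<and> open D \<and> \<phi> (\<pi> z) \<in> D \<and> D \<subseteq> \<phi> ` U \<and>
        smooth_on D \<sigma> \<and> \<sigma> (\<phi> (\<pi> z)) = z \<and> (\<forall>x\<in>D. \<sigma> x \<in> S \<and> \<pi> (\<sigma> x) = inv_into U \<phi> x))"

text \<open>
  \<open>\<pi>\<^sup>*\<omega> = \<kappa>\<^sup>*\<Omega>\<close> for the inclusion \<open>\<kappa>\<close> of \<open>S\<close>, where \<open>\<Omega>\<close> is a constant form on the ambient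
  space: tangent vectors of \<open>S\<close> are the derivatives \<open>c'(0)\<close> of curves in \<open>S\<close>, and \<open>d\<pi>\<close> maps them
  to the velocities of the projected curves.
\<close>

definition pullback_agrees ::
  "'a::euclidean_space set \<Rightarrow> ('m, 'e::euclidean_space) atlas \<Rightarrow> ('a \<Rightarrow> 'm) \<Rightarrow> 'm two_form \<Rightarrow>
   ('a \<Rightarrow> 'a \<Rightarrow> real) \<Rightarrow> bool" where
  "pullback_agrees S A \<pi> \<omega> \<Omega> \<longleftrightarrow>
     (\<forall>c d e. e > 0 \<and> smooth_on {-e<..<e} c \<and> smooth_on {-e<..<e} d \<and>
        c ` {-e<..<e} \<subseteq> S \<and> d ` {-e<..<e} \<subseteq> S \<and> c 0 = d 0 \<longrightarrow>
        \<omega> (\<pi> (c 0)) (velocity A (\<lambda>t. \<pi> (c t))) (velocity A (\<lambda>t. \<pi> (d t))) =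
        \<Omega> (vector_derivative c (at 0)) (vector_derivative d (at 0)))"

section \<open>The octagon manifold\<close>

text \<open>
  The index type \<open>8\<close> is arithmetic modulo 8, so that \<open>z $ 1, \<dots>, z $ 8\<close> are the eight
  coordinates.
\<close>

definition omega_st :: "complex ^ 8 \<Rightarrow> complex ^ 8 \<Rightarrow> real" where
  "omega_st u v = (\<Sum>k\<in>UNIV. Re (u $ k) * Im (v $ k) - Im (u $ k) * Re (v $ k))"

definition W :: "(complex ^ 8) set" where
  "W = {z. (cmod (z $ 1))\<^sup>2 + (cmod (z $ 5))\<^sup>2 = 6 \<and>
           (cmod (z $ 2))\<^sup>2 + (cmod (z $ 5))\<^sup>2 + (cmod (z $ 7))\<^sup>2 = 10 \<and>
           (cmod (z $ 3))\<^sup>2 + (cmod (z $ 7))\<^sup>2 = 6 \<and>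
           (cmod (z $ 4))\<^sup>2 - (cmod (z $ 5))\<^sup>2 + (cmod (z $ 7))\<^sup>2 = 4 \<and>
           (cmod (z $ 5))\<^sup>2 - (cmod (z $ 6))\<^sup>2 + (cmod (z $ 7))\<^sup>2 = 2 \<and>
           (cmod (z $ 5))\<^sup>2 - (cmod (z $ 7))\<^sup>2 + (cmod (z $ 8))\<^sup>2 = 4}"

definition N_act :: "real ^ 6 \<Rightarrow> complex ^ 8 \<Rightarrow> complex ^ 8" where
  "N_act t z = vector
     [cis (t $ 1) * z $ 1,
      cis (t $ 2) * z $ 2,
      cis (t $ 3) * z $ 3,
      cis (t $ 4) * z $ 4,
      cis (t $ 1 + t $ 2 - t $ 4 - t $ 5 + t $ 6) * z $ 5,
      cis (t $ 5) * z $ 6,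
      cis (t $ 2 + t $ 3 + t $ 4 - t $ 5 - t $ 6) * z $ 7,
      cis (t $ 6) * z $ 8]"

text \<open>Points of \<open>M = W/N\<close> are orbits, and \<open>\<tau>\<close> is the quotient map.\<close>

definition \<tau> :: "complex ^ 8 \<Rightarrow> (complex ^ 8) set" where
  "\<tau> z = range (\<lambda>t. N_act t z)"

definition M :: "(complex ^ 8) set set" where
  "M = \<tau> ` W"

definition M_top :: "(complex ^ 8) set topology" where
  "M_top = quotient_topology W \<tau>"

definition J :: "(complex ^ 8) set \<Rightarrow> real" where
  "J p = (THE r. \<forall>z\<in>p. r = 1/2 * (cmod (z $ 1))\<^sup>2)"

definition H :: "(complex ^ 8) set \<Rightarrow> real" where
  "H p = (THE r. \<forall>z\<in>p. r = 1/2 * (cmod (z $ 3))\<^sup>2)"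

definition F :: "(complex ^ 8) set \<Rightarrow> real ^ 2" where
  "F p = vector [J p, H p]"

definition octagon :: "(real ^ 2) set" where
  "octagon = convex hull
     {vector [0, 2], vector [0, 1], vector [1, 0], vector [2, 0],
      vector [3, 1], vector [3, 2], vector [2, 3], vector [1, 3]}"

end

theory Submission
  imports Defs
begin

text \<open>
  The standard action of the eight-dimensional torus on \<open>W\<close> by rotation of the coordinates
  commutes with \<open>N\<close> and hence descends to \<open>M\<close>. Rotating \<open>z\<^sub>1\<close> and \<open>z\<^sub>3\<close> clockwise gives the
  two-torus action, and its two circle factors are the actions belonging to \<open>J\<close> and \<open>H\<close>.

  That the action is Hamiltonian is checked upstairs. A tangent vector of \<open>M\<close> is the velocity of
  a curve, which lifts along a local section of \<open>\<tau>\<close> to a curve in \<open>W\<close> through any prescribed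
  point of the fibre (\<open>tangent_vector_lift\<close>). As \<open>\<tau>\<^sup>*\<omega> = \<kappa>\<^sup>*\<omega>\<^sub>s\<^sub>t\<close>, the value of \<open>\<omega>\<close> on two tangent
  vectors is the standard form on the derivatives of the lifts. Invariance of \<open>\<omega>\<close> is thus
  invariance of the standard form under rotations (\<open>linear_symmetry_preserves_form\<close>), and
  Hamilton's equation for the rotation with velocities \<open>\<theta>\<^sub>k\<close> and the function
  \<open>- \<Sum> \<theta>\<^sub>k \<bar>z\<^sub>k\<bar>\<^sup>2 / 2\<close> is the familiar one in the linear space (\<open>rot_momentum_derivative\<close>,
  \<open>velocity_dual_to_differential\<close>). Nondegeneracy makes the solution of Hamilton's equation unique,
  so that the circle actions are indeed the flows of the Hamiltonian vector fields
  (\<open>hamiltonian_vector_field_eqI\<close>).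

  On \<open>W\<close> all \<open>\<bar>z\<^sub>k\<bar>\<^sup>2\<close> are affine functions of \<open>J\<close> and \<open>H\<close>, and their nonnegativity is the
  description of the octagon by half-planes (\<open>momentum_image\<close>). The action is effective because
  over the centre of the octagon no coordinate vanishes, and comparing phases there shows that a
  rotation of \<open>z\<^sub>1\<close> and \<open>z\<^sub>3\<close> that agrees with an element of \<open>N\<close> is trivial
  (\<open>effective_at_center\<close>).
\<close>

section \<open>Calculus of smooth maps\<close>

lemma Ck_on_cong:
  assumes "open S" "\<And>x. x \<in> S \<Longrightarrow> f x = g x"
  shows "Ck_on n S f \<longleftrightarrow> Ck_on n S g"
proof -
  have *: "Ck_on n S g" if "Ck_on n S f" "\<And>x. x \<in> S \<Longrightarrow> f x = g x" for f g :: "'a \<Rightarrow> 'b"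
    using that
  proof (induction n arbitrary: f g)
    case 0
    then show ?case by (auto cong: continuous_on_cong)
  next
    case (Suc n)
    have d: "(g has_derivative frechet_derivative f (at x)) (at x)" if "x \<in> S" for x
    proof (rule has_derivative_transform_within_open[OF _ assms(1) that])
      show "(f has_derivative frechet_derivative f (at x)) (at x)"
        using Suc.prems(1) that by (simp add: frechet_derivative_works)
    qed (use Suc.prems(2) in auto)
    then have e: "frechet_derivative f (at x) = frechet_derivative g (at x)" if "x \<in> S" for x
      using that frechet_derivative_at by blast
    have "Ck_on n S (\<lambda>x. frechet_derivative g (at x) v)" for v
      by (rule Suc.IH[of "\<lambda>x. frechet_derivative f (at x) v"]) (use Suc.prems(1) e in auto)
    moreover have "\<forall>x\<in>S. g differentiable (at x)" using d unfolding differentiable_def by blast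
    ultimately show ?case by simp
  qed
  show ?thesis using *[of f g] *[of g f] assms(2) by auto
qed

lemma Ck_on_subset: "Ck_on n S f \<Longrightarrow> T \<subseteq> S \<Longrightarrow> Ck_on n T f"
  by (induction n arbitrary: f) (auto intro: continuous_on_subset)

lemma Ck_on_SucD: "Ck_on (Suc n) S f \<Longrightarrow> Ck_on n S f"
proof (induction n arbitrary: f)
  case 0
  then have "f differentiable_on S"
    by (simp add: differentiable_at_imp_differentiable_on)
  then show ?case by (simp add: differentiable_imp_continuous_on)
next
  case (Suc n)
  have "Ck_on n S (\<lambda>x. frechet_derivative f (at x) v)" for v
    by (rule Suc.IH) (use Suc.prems in simp)
  then show ?case using Suc.prems by simp
qed

lemma Ck_on_SucI:
  assumes "open S" "\<And>x. x \<in> S \<Longrightarrow> (f has_derivative f' x) (at x)"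
    "\<And>v. Ck_on n S (\<lambda>x. f' x v)"
  shows "Ck_on (Suc n) S f"
proof -
  have "frechet_derivative f (at x) = f' x" if "x \<in> S" for x
    using assms(2)[OF that] frechet_derivative_at by metis
  then have "Ck_on n S (\<lambda>x. frechet_derivative f (at x) v)" for v
    using assms(1,3) by (subst Ck_on_cong[where g = "\<lambda>x. f' x v"]) auto
  then show ?thesis
    using assms(2) by (auto simp: differentiable_def)
qed

lemma Ck_on_has_derivative:
  "Ck_on (Suc n) S f \<Longrightarrow> x \<in> S \<Longrightarrow> (f has_derivative frechet_derivative f (at x)) (at x)"
  by (simp add: frechet_derivative_works)

lemma Ck_on_const: "Ck_on n S (\<lambda>_. c)"
  by (induction n arbitrary: c) (auto simp: frechet_derivative_const)

lemma Ck_on_add: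
  assumes "open S" "Ck_on n S f" "Ck_on n S g"
  shows "Ck_on n S (\<lambda>x. f x + g x)"
  using assms(2,3)
proof (induction n arbitrary: f g)
  case 0
  then show ?case by (auto intro: continuous_intros)
next
  case (Suc n)
  show ?case
    by (rule Ck_on_SucI[OF assms(1) has_derivative_add[OF Ck_on_has_derivative Ck_on_has_derivative]])
      (use Suc in auto)
qed

lemma Ck_on_sum:
  assumes "open S" "finite I" "\<And>i. i \<in> I \<Longrightarrow> Ck_on n S (f i)"
  shows "Ck_on n S (\<lambda>x. \<Sum>i\<in>I. f i x)"
  using assms(2,3) by (induction) (auto intro: Ck_on_const Ck_on_add[OF assms(1)])

lemma Ck_on_bounded_linear:
  assumes "open S" "bounded_linear l" "Ck_on n S f"
  shows "Ck_on n S (\<lambda>x. l (f x))"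
  using assms(3)
proof (induction n arbitrary: f)
  case 0
  then show ?case by (auto intro: bounded_linear.continuous_on[OF assms(2)])
next
  case (Suc n)
  show ?case
    by (rule Ck_on_SucI[OF assms(1) bounded_linear.has_derivative[OF assms(2) Ck_on_has_derivative]])
      (use Suc in auto)
qed

text \<open>
  The product rule expresses the derivative of a product by products of functions of class
  \<open>n\<close>, so smoothness of products needs no formula for higher derivatives. Bilinearity in
  the abstract covers scalar, inner and complex products at once.
\<close>

lemma Ck_on_bounded_bilinear:
  assumes "open S" "bounded_bilinear B" "Ck_on n S f" "Ck_on n S g"
  shows "Ck_on n S (\<lambda>x. B (f x) (g x))"
  using assms(3,4)
proof (induction n arbitrary: f g)
  case 0
  then show ?case by (auto intro: bounded_bilinear.continuous_on[OF assms(2)])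
next
  case (Suc n)
  have "Ck_on n S f" "Ck_on n S g" using Suc.prems by (auto intro: Ck_on_SucD)
  then show ?case
    by (intro Ck_on_SucI[OF assms(1) bounded_bilinear.FDERIV[OF assms(2) Ck_on_has_derivative Ck_on_has_derivative]])
      (use Suc assms(1) in \<open>auto intro!: Ck_on_add\<close>)
qed

text \<open>
  The chain rule composes derivatives as linear maps, whereas the class \<open>n\<close> speaks of
  derivatives in fixed directions. Expanding the inner derivative in a basis writes
  \<open>D(g \<circ> f)(x) v\<close> as a finite sum of products of a coefficient of \<open>Df(x) v\<close> and a function
  \<open>Dg(f x) b\<close> with \<open>b\<close> fixed, to which the induction hypothesis applies.
\<close>

lemma Ck_on_compose:
  assumes "open S" "open T" "f ` S \<subseteq> T" "Ck_on n S f" "Ck_on n T g"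
  shows "Ck_on n S (\<lambda>x. g (f x))"
  using assms(4,5)
proof (induction n arbitrary: g)
  case 0
  then show ?case using assms(3) by (auto intro: continuous_on_compose2)
next
  case (Suc n)
  let ?f' = "\<lambda>x. frechet_derivative f (at x)" and ?g' = "\<lambda>y. frechet_derivative g (at y)"
  have g': "linear (?g' (f x))" if "x \<in> S" for x
    using that assms(3) Suc.prems(2) by (simp add: image_subset_iff linear_frechet_derivative)
  have eq: "?g' (f x) (?f' x v) = (\<Sum>b\<in>Basis. (?f' x v \<bullet> b) *\<^sub>R ?g' (f x) b)" if "x \<in> S" for x v
    using linear_sum[OF g'[OF that], of "\<lambda>b. (?f' x v \<bullet> b) *\<^sub>R b" Basis]
    by (simp add: euclidean_representation linear_cmul[OF g'[OF that]])
  have "Ck_on n S (\<lambda>x. \<Sum>b\<in>Basis. (?f' x v \<bullet> b) *\<^sub>R ?g' (f x) b)" for v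
    using Suc.prems Ck_on_SucD[OF Suc.prems(1)]
    by (intro Ck_on_sum assms(1) finite_Basis Ck_on_bounded_bilinear[OF _ bounded_bilinear_scaleR]
        Ck_on_bounded_linear[OF _ bounded_linear_inner_left] Suc.IH) auto
  then have "Ck_on n S (\<lambda>x. ?g' (f x) (?f' x v))" for v
    using eq by (subst Ck_on_cong[OF assms(1)]) auto
  moreover have "((\<lambda>x. g (f x)) has_derivative (\<lambda>v. ?g' (f x) (?f' x v))) (at x)" if "x \<in> S" for x
    using Suc.prems that assms(3)
    by (intro has_derivative_compose[OF Ck_on_has_derivative[OF Suc.prems(1)] Ck_on_has_derivative[OF Suc.prems(2)]]) auto
  ultimately show ?case by (intro Ck_on_SucI[OF assms(1)])
qed

lemma Ck_on_id: "Ck_on n S (\<lambda>x. x)"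
  by (cases n) (auto simp: frechet_derivative_ident Ck_on_const)

lemma Ck_on_linear: "open S \<Longrightarrow> bounded_linear l \<Longrightarrow> Ck_on n S l"
  by (rule Ck_on_bounded_linear[OF _ _ Ck_on_id])

text \<open>
  The derivative of \<open>cis\<close> is again \<open>cis\<close>, multiplied by a constant.
\<close>

lemma Ck_on_cis: "Ck_on n UNIV cis"
proof (induction n)
  case 0
  show ?case by (auto intro: continuous_intros)
next
  case (Suc n)
  have "(cis has_derivative (\<lambda>h. h *\<^sub>R (\<i> * cis t))) (at t)" for t
    using has_derivative_cis[OF has_derivative_ident] .
  moreover have "Ck_on n UNIV (\<lambda>t. v *\<^sub>R (\<i> * cis t))" for v
    by (intro Ck_on_bounded_linear[OF _ bounded_linear_scaleR_right]
        Ck_on_bounded_linear[OF _ bounded_linear_mult_right] Suc) auto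
  ultimately show ?case by (intro Ck_on_SucI) auto
qed

lemma smooth_onI_Ck: "open U \<Longrightarrow> S \<subseteq> U \<Longrightarrow> (\<And>n. Ck_on n U f) \<Longrightarrow> smooth_on S f"
  by (auto simp: smooth_on_def intro!: exI[of _ U] exI[of _ f])

lemma smooth_on_extends:
  assumes "smooth_on S f" "x \<in> S"
  shows "\<exists>U g. open U \<and> x \<in> U \<and> (\<forall>n. Ck_on n U g) \<and> (\<forall>y\<in>S \<inter> U. g y = f y)"
  using assms unfolding smooth_on_def by (rule bspec)

lemma smooth_onI:
  assumes "\<And>x. x \<in> S \<Longrightarrow> \<exists>U g. open U \<and> x \<in> U \<and> (\<forall>n. Ck_on n U g) \<and> (\<forall>y\<in>S \<inter> U. g y = f y)"
  shows "smooth_on S f"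
  using assms unfolding smooth_on_def by (rule ballI)

lemma smooth_on_subset:
  assumes "smooth_on S f" "T \<subseteq> S"
  shows "smooth_on T f"
proof (rule smooth_onI)
  fix x assume "x \<in> T"
  obtain U g where "open U" "x \<in> U" "\<forall>n. Ck_on n U g" "\<forall>y\<in>S \<inter> U. g y = f y"
    using smooth_on_extends[OF assms(1) subsetD[OF assms(2) \<open>x \<in> T\<close>]] by (elim exE conjE) (rule that)
  then show "\<exists>U g. open U \<and> x \<in> U \<and> (\<forall>n. Ck_on n U g) \<and> (\<forall>y\<in>T \<inter> U. g y = f y)"
    using assms(2) by (intro exI[of _ U] exI[of _ g]) auto
qed

lemma smooth_on_cong:
  assumes "smooth_on S f" "\<And>x. x \<in> S \<Longrightarrow> f x = g x"
  shows "smooth_on S g"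
  using assms by (simp add: smooth_on_def)

text \<open>
  Local extensions near a point of a relatively open subset can be cut down to an ambient
  neighbourhood that meets the whole set only in that subset.
\<close>

lemma smooth_on_local:
  assumes "\<And>x. x \<in> S \<Longrightarrow> \<exists>T. openin (top_of_set S) T \<and> x \<in> T \<and> smooth_on T f"
  shows "smooth_on S f"
proof (rule smooth_onI)
  fix x assume "x \<in> S"
  then obtain T where T: "openin (top_of_set S) T" "x \<in> T" "smooth_on T f" using assms by blast
  then obtain V where V: "open V" "T = S \<inter> V" by (auto simp: openin_open)
  obtain U g where U: "open U" "x \<in> U" "\<forall>n. Ck_on n U g" "\<forall>y\<in>T \<inter> U. g y = f y"
    using smooth_on_extends[OF T(3,2)] by (elim exE conjE) (rule that)
  show "\<exists>U g. open U \<and> x \<in> U \<and> (\<forall>n. Ck_on n U g) \<and> (\<forall>y\<in>S \<inter> U. g y = f y)"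
    by (rule exI[of _ "U \<inter> V"], rule exI[of _ g])
      (use U V T(2) in \<open>auto intro: Ck_on_subset\<close>)
qed

lemma smooth_on_continuous:
  assumes "smooth_on S f" shows "continuous_on S f"
  unfolding continuous_on_eq_continuous_within
proof
  fix x assume x: "x \<in> S"
  obtain U g where U: "open U" "x \<in> U" "\<forall>n. Ck_on n U g" "\<forall>y\<in>S \<inter> U. g y = f y"
    using smooth_on_extends[OF assms x] by (elim exE conjE) (rule that)
  have "continuous_on U g" using U(3)[rule_format, of 0] by simp
  then have "isCont g x" using U by (simp add: continuous_on_eq_continuous_at)
  show "continuous (at x within S) f"
    by (rule continuous_transform_within_openin[of x S g "S \<inter> U"])
      (use U x \<open>isCont g x\<close> in \<open>auto intro: openin_open_Int continuous_at_imp_continuous_at_within\<close>)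
qed

lemma smooth_on_compose:
  assumes "smooth_on S f" "smooth_on T g" "f ` S \<subseteq> T"
  shows "smooth_on S (\<lambda>x. g (f x))"
proof (rule smooth_onI)
  fix x assume x: "x \<in> S"
  obtain U f' where U: "open U" "x \<in> U" "\<forall>n. Ck_on n U f'" "\<forall>y\<in>S \<inter> U. f' y = f y"
    using smooth_on_extends[OF assms(1) x] by (elim exE conjE) (rule that)
  have "f x \<in> T" using x assms(3) by auto
  obtain V g' where V: "open V" "f x \<in> V" "\<forall>n. Ck_on n V g'" "\<forall>y\<in>T \<inter> V. g' y = g y"
    using smooth_on_extends[OF assms(2) \<open>f x \<in> T\<close>] by (elim exE conjE) (rule that)
  have "continuous_on U f'" using U(3)[rule_format, of 0] by simp
  then have o: "open (U \<inter> f' -` V)" using U V by (simp add: continuous_on_open_vimage Int_commute)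
  show "\<exists>U h. open U \<and> x \<in> U \<and> (\<forall>n. Ck_on n U h) \<and> (\<forall>y\<in>S \<inter> U. h y = g (f y))"
  proof (intro exI[of _ "U \<inter> f' -` V"] exI[of _ "\<lambda>x. g' (f' x)"] conjI allI ballI o)
    show "Ck_on n (U \<inter> f' -` V) (\<lambda>x. g' (f' x))" for n
      by (rule Ck_on_compose[OF o V(1)]) (use U V in \<open>auto intro: Ck_on_subset\<close>)
  qed (use U V x assms(3) in auto)
qed

lemma smooth_on_Pair:
  assumes "smooth_on S f" "smooth_on S g"
  shows "smooth_on S (\<lambda>x. (f x, g x))"
proof (rule smooth_onI)
  fix x assume x: "x \<in> S"
  obtain U f' where U: "open U" "x \<in> U" "\<forall>n. Ck_on n U f'" "\<forall>y\<in>S \<inter> U. f' y = f y"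
    using smooth_on_extends[OF assms(1) x] by (elim exE conjE) (rule that)
  obtain V g' where V: "open V" "x \<in> V" "\<forall>n. Ck_on n V g'" "\<forall>y\<in>S \<inter> V. g' y = g y"
    using smooth_on_extends[OF assms(2) x] by (elim exE conjE) (rule that)
  have o: "open (U \<inter> V)" using U V by auto
  have "Ck_on n (U \<inter> V) (\<lambda>x. (f' x, 0) + (0, g' x))" for n
    by (intro Ck_on_add o Ck_on_bounded_linear[where l = "\<lambda>a. (a, 0)"]
        Ck_on_bounded_linear[where l = "\<lambda>a. (0, a)"] bounded_linear_Pair bounded_linear_ident
        bounded_linear_zero)
      (use U V in \<open>auto intro: Ck_on_subset\<close>)
  then show "\<exists>U h. open U \<and> x \<in> U \<and> (\<forall>n. Ck_on n U h) \<and> (\<forall>y\<in>S \<inter> U. h y = (f y, g y))"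
    by (intro exI[of _ "U \<inter> V"] exI[of _ "\<lambda>x. (f' x, 0) + (0, g' x)"]) (use U V in auto)
qed

lemma smooth_on_differentiable:
  assumes "smooth_on S f" "open S" "x \<in> S"
  shows "f differentiable (at x)"
proof -
  obtain U g where U: "open U" "x \<in> U" "\<forall>n. Ck_on n U g" "\<forall>y\<in>S \<inter> U. g y = f y"
    using smooth_on_extends[OF assms(1,3)] by (elim exE conjE) (rule that)
  have "g differentiable (at x)" using U(3)[rule_format, of "Suc 0"] U(2) by simp
  then obtain g' where "(g has_derivative g') (at x)" unfolding differentiable_def by blast
  then have "(f has_derivative g') (at x)"
    by (rule has_derivative_transform_within_open[of g g' x UNIV "S \<inter> U"]) (use U assms in auto)
  then show ?thesis unfolding differentiable_def by blast
qed

lemma smooth_on_linear: "bounded_linear l \<Longrightarrow> smooth_on S l"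
  by (rule smooth_onI_Ck[of UNIV]) (auto intro: Ck_on_linear)

section \<open>Smooth quotients of subsets of Euclidean spaces\<close>

lemma inv_into_id: "x \<in> S \<Longrightarrow> inv_into S id x = x"
  using inv_into_f_f[of id S x] by simp

lemma velocity_cong_near_0:
  assumes "e > 0" "\<And>t. \<bar>t\<bar> < e \<Longrightarrow> c t = c' t"
  shows "velocity A c = velocity A c'"
proof -
  have "\<forall>\<^sub>F t in nhds 0. f (c t) = f (c' t)" for f :: "'a \<Rightarrow> real"
    using assms by (auto simp: eventually_nhds_metric)
  then show ?thesis unfolding velocity_def by (intro ext if_cong refl deriv_cong_ev) auto
qed

text \<open>
  A manifold \<open>A\<close> that is the image of a subset \<open>S\<close> of a Euclidean space under a submersion
  \<open>\<pi>\<close>. Local sections reduce every question about the manifold to one about \<open>S\<close>, where the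
  calculus of Euclidean spaces applies.
\<close>

locale smooth_quotient =
  fixes S :: "'a::euclidean_space set" and \<pi> :: "'a \<Rightarrow> 'm" and A :: "('m, 'e::euclidean_space) atlas"
  assumes manifold: "smooth_manifold (quotient_topology S \<pi>) A"
    and submersion: "smooth_submersion S A \<pi>"
begin

lemma topspace_quotient: "topspace (quotient_topology S \<pi>) = \<pi> ` S"
proof -
  have "{z \<in> S. \<pi> z \<in> \<pi> ` S} = S" by auto
  then have "openin (quotient_topology S \<pi>) (\<pi> ` S)" by (simp add: openin_quotient_topology)
  moreover have "topspace (quotient_topology S \<pi>) \<subseteq> \<pi> ` S"
    unfolding topspace_def by (auto simp: openin_quotient_topology)
  ultimately show ?thesis by (simp add: openin_subset subset_antisym)
qed

lemma carrier_eq: "atlas_carrier A = \<pi> ` S"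
  using manifold by (simp add: smooth_manifold_def topspace_quotient)

lemma chart:
  assumes "(U, \<phi>) \<in> A"
  shows "openin (quotient_topology S \<pi>) U" "open (\<phi> ` U)" "inj_on \<phi> U" "U \<subseteq> \<pi> ` S"
    "homeomorphic_map (subtopology (quotient_topology S \<pi>) U) (top_of_set (\<phi> ` U)) \<phi>"
proof -
  show *: "openin (quotient_topology S \<pi>) U" "open (\<phi> ` U)" and
    h: "homeomorphic_map (subtopology (quotient_topology S \<pi>) U) (top_of_set (\<phi> ` U)) \<phi>"
    using manifold assms unfolding smooth_manifold_def by fast+
  show "U \<subseteq> \<pi> ` S" using * by (auto simp: openin_quotient_topology)
  then have "topspace (subtopology (quotient_topology S \<pi>) U) = U"
    by (auto simp: topspace_quotient)
  then show "inj_on \<phi> U" using homeomorphic_imp_injective_map[OF h] by simp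
qed

lemma chart_domain_open: "(U, \<phi>) \<in> A \<Longrightarrow> openin (top_of_set S) {z \<in> S. \<pi> z \<in> U}"
  using chart(1) by (auto simp: openin_quotient_topology)

lemma chart_projection_smooth: "(U, \<phi>) \<in> A \<Longrightarrow> smooth_on {z \<in> S. \<pi> z \<in> U} (\<lambda>z. \<phi> (\<pi> z))"
  using submersion unfolding smooth_submersion_def by (auto simp: o_def)

lemma chart_around: "z \<in> S \<Longrightarrow> \<exists>U \<phi>. (U, \<phi>) \<in> A \<and> \<pi> z \<in> U"
  using imageI[of z S \<pi>] by (auto simp: carrier_eq[symmetric] atlas_carrier_def)

lemma local_section:
  assumes "z \<in> S"
  shows "\<exists>U \<phi> D \<sigma>. (U, \<phi>) \<in> A \<and> \<pi> z \<in> U \<and> open D \<and> \<phi> (\<pi> z) \<in> D \<and> D \<subseteq> \<phi> ` U \<and>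
    smooth_on D \<sigma> \<and> \<sigma> (\<phi> (\<pi> z)) = z \<and> (\<forall>x\<in>D. \<sigma> x \<in> S) \<and> (\<forall>x\<in>D. \<pi> (\<sigma> x) = inv_into U \<phi> x)"
proof -
  have "\<exists>(U, \<phi>)\<in>A. \<exists>D \<sigma>. \<pi> z \<in> U \<and> open D \<and> \<phi> (\<pi> z) \<in> D \<and> D \<subseteq> \<phi> ` U \<and>
      smooth_on D \<sigma> \<and> \<sigma> (\<phi> (\<pi> z)) = z \<and> (\<forall>x\<in>D. \<sigma> x \<in> S \<and> \<pi> (\<sigma> x) = inv_into U \<phi> x)"
    using submersion assms unfolding smooth_submersion_def by (elim conjE) (rule bspec)
  then show ?thesis by (simp add: Bex_def ball_conj_distrib)
qed

text \<open>
  Charts of the quotient are smooth functions on \<open>S\<close>, which gives one direction; composing with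
  a local section gives the other.
\<close>

lemma smooth_map_iff:
  "smooth_map A (euclidean_atlas UNIV) f \<longleftrightarrow> smooth_on S (\<lambda>z. f (\<pi> z))"
proof
  assume f: "smooth_map A (euclidean_atlas UNIV) f"
  show "smooth_on S (\<lambda>z. f (\<pi> z))"
  proof (rule smooth_on_local)
    fix z assume z: "z \<in> S"
    then have "\<pi> z \<in> atlas_carrier A" by (simp add: carrier_eq)
    then obtain U \<phi> D where U: "(U, \<phi>) \<in> A" "\<pi> z \<in> U" "open D" "\<phi> (\<pi> z) \<in> D"
      "smooth_on D (\<lambda>x. f (inv_into U \<phi> x))"
      using f unfolding smooth_map_def by (force simp: euclidean_atlas_def)
    let ?T = "{z \<in> S. \<pi> z \<in> U} \<inter> (\<lambda>z. \<phi> (\<pi> z)) -` D"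
    have "openin (top_of_set S) ?T"
      using continuous_openin_preimage_gen[OF smooth_on_continuous[OF chart_projection_smooth[OF U(1)]] U(3)]
        chart_domain_open[OF U(1)] by (rule openin_trans)
    moreover have "smooth_on ?T (\<lambda>z. f (inv_into U \<phi> (\<phi> (\<pi> z))))"
      by (rule smooth_on_compose[OF smooth_on_subset[OF chart_projection_smooth[OF U(1)]] U(5)]) auto
    then have "smooth_on ?T (\<lambda>z. f (\<pi> z))"
      by (rule smooth_on_cong) (use chart(3)[OF U(1)] in auto)
    ultimately show "\<exists>T. openin (top_of_set S) T \<and> z \<in> T \<and> smooth_on T (\<lambda>z. f (\<pi> z))"
      using z U by blast
  qed
next
  assume f: "smooth_on S (\<lambda>z. f (\<pi> z))"
  show "smooth_map A (euclidean_atlas UNIV) f"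
    unfolding smooth_map_def
  proof
    fix p assume "p \<in> atlas_carrier A"
    then obtain z where z: "z \<in> S" "p = \<pi> z" by (auto simp: carrier_eq)
    obtain U \<phi> D \<sigma> where U: "(U, \<phi>) \<in> A" "\<pi> z \<in> U" "open D" "\<phi> (\<pi> z) \<in> D" "D \<subseteq> \<phi> ` U"
    "smooth_on D \<sigma>" "\<sigma> (\<phi> (\<pi> z)) = z" "\<forall>x\<in>D. \<sigma> x \<in> S" "\<forall>x\<in>D. \<pi> (\<sigma> x) = inv_into U \<phi> x"
    using local_section[OF z(1)] by (elim exE conjE) (rule that)
    have "smooth_on D (\<lambda>x. f (\<pi> (\<sigma> x)))"
      by (rule smooth_on_compose[OF U(6) f]) (use U in auto)
    then have "smooth_on D (\<lambda>x. f (inv_into U \<phi> x))"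
      by (rule smooth_on_cong) (use U in auto)
    then show "\<exists>(U, \<phi>)\<in>A. \<exists>(V, \<psi>)\<in>euclidean_atlas UNIV. \<exists>D. p \<in> U \<and> open D \<and> \<phi> p \<in> D \<and>
        D \<subseteq> \<phi> ` U \<and> (\<forall>x\<in>D. f (inv_into U \<phi> x) \<in> V) \<and> smooth_on D (\<lambda>x. \<psi> (f (inv_into U \<phi> x)))"
      using U z by (intro bexI[OF _ U(1)]) (auto simp: euclidean_atlas_def)
  qed
qed

lemma smooth_functions_iff: "f \<in> smooth_functions A \<longleftrightarrow> smooth_on S (\<lambda>z. f (\<pi> z))"
  by (simp add: smooth_functions_def smooth_map_iff)

lemma preimage_domain_open:
  assumes "open I" "smooth_on I g" "g ` I \<subseteq> S" "(V, \<psi>) \<in> A"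
  shows "open (I \<inter> (\<lambda>t. \<pi> (g t)) -` V)"
proof -
  obtain T where T: "open T" "{z \<in> S. \<pi> z \<in> V} = S \<inter> T"
    using chart_domain_open[OF assms(4)] by (auto simp: openin_open)
  have "I \<inter> (\<lambda>t. \<pi> (g t)) -` V = I \<inter> g -` T"
    using T(2) assms(3) by blast
  moreover have "open (I \<inter> g -` T)"
    using smooth_on_continuous[OF assms(2)] assms(1) T(1)
    by (simp add: continuous_on_open_vimage Int_commute)
  ultimately show ?thesis by simp
qed

lemma smooth_map_project:
  assumes "open I" "smooth_on I g" "g ` I \<subseteq> S"
  shows "smooth_map (euclidean_atlas I) A (\<lambda>t. \<pi> (g t))"
  unfolding smooth_map_def
proof
  fix t assume "t \<in> atlas_carrier (euclidean_atlas I)"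
  then have t: "t \<in> I" by (simp add: atlas_carrier_def euclidean_atlas_def)
  then obtain V \<psi> where V: "(V, \<psi>) \<in> A" "\<pi> (g t) \<in> V" using chart_around assms(3) by blast
  let ?D = "I \<inter> (\<lambda>t. \<pi> (g t)) -` V"
  have "smooth_on ?D (\<lambda>t. \<psi> (\<pi> (g t)))"
    by (rule smooth_on_compose[OF smooth_on_subset[OF assms(2)] chart_projection_smooth[OF V(1)]])
      (use assms(3) in auto)
  then have "smooth_on ?D (\<lambda>t. \<psi> (\<pi> (g (inv_into I id t))))"
    by (rule smooth_on_cong) (simp add: inv_into_id)
  then show "\<exists>(U, \<phi>)\<in>euclidean_atlas I. \<exists>(V, \<psi>)\<in>A. \<exists>D. t \<in> U \<and> open D \<and> \<phi> t \<in> D \<and> D \<subseteq> \<phi> ` U \<and>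
      (\<forall>x\<in>D. \<pi> (g (inv_into U \<phi> x)) \<in> V) \<and> smooth_on D (\<lambda>x. \<psi> (\<pi> (g (inv_into U \<phi> x))))"
    using t V preimage_domain_open[OF assms V(1)]
    by (auto simp: euclidean_atlas_def inv_into_id intro!: bexI[OF _ V(1)] exI[of _ ?D])
qed

text \<open>
  Near \<open>(t, \<pi> z)\<close> the descended map is \<open>\<pi> \<circ> R\<close> precomposed with a local section through
  \<open>z\<close>, so it inherits smoothness from \<open>R\<close>.
\<close>

lemma smooth_map_prod_descends:
  fixes R :: "'t::euclidean_space \<Rightarrow> 'a \<Rightarrow> 'a"
  assumes R: "smooth_on (UNIV \<times> S) (\<lambda>(t, z). R t z)" "\<And>t z. z \<in> S \<Longrightarrow> R t z \<in> S"
    and \<rho>: "\<And>t z. z \<in> S \<Longrightarrow> \<rho> t (\<pi> z) = \<pi> (R t z)"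
  shows "smooth_map (prod_atlas (euclidean_atlas UNIV) A) A (\<lambda>(t, p). \<rho> t p)"
  unfolding smooth_map_def
proof
  fix q assume "q \<in> atlas_carrier (prod_atlas (euclidean_atlas (UNIV :: 't set)) A)"
  then obtain C where C: "C \<in> prod_atlas (euclidean_atlas (UNIV :: 't set)) A" "q \<in> fst C"
    by (auto simp: atlas_carrier_def)
  then obtain V \<psi> where "(V, \<psi>) \<in> A" "fst C = UNIV \<times> V"
    by (auto simp: prod_atlas_def euclidean_atlas_def)
  then have "snd q \<in> atlas_carrier A" using C(2) by (force simp: atlas_carrier_def)
  then obtain t z where z: "z \<in> S" and q: "q = (t, \<pi> z)" by (cases q) (auto simp: carrier_eq)
  obtain U \<phi> D \<sigma> where U: "(U, \<phi>) \<in> A" "\<pi> z \<in> U" "open D" "\<phi> (\<pi> z) \<in> D" "D \<subseteq> \<phi> ` U"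
    "smooth_on D \<sigma>" "\<sigma> (\<phi> (\<pi> z)) = z" "\<forall>x\<in>D. \<sigma> x \<in> S" "\<forall>x\<in>D. \<pi> (\<sigma> x) = inv_into U \<phi> x"
    using local_section[OF z] by (elim exE conjE) (rule that)
  obtain V \<psi> where V: "(V, \<psi>) \<in> A" "\<pi> (R t z) \<in> V" using chart_around[OF R(2)[OF z]] by blast
  let ?g = "\<lambda>y. (\<lambda>(t, z). R t z) (fst y, \<sigma> (snd y))"
  have g: "smooth_on (UNIV \<times> D) ?g"
    by (rule smooth_on_compose[OF smooth_on_Pair[OF smooth_on_linear[OF bounded_linear_fst]
          smooth_on_compose[OF smooth_on_linear[OF bounded_linear_snd] U(6)]] R(1)])
      (use U(8) in auto)
  have gS: "?g ` (UNIV \<times> D) \<subseteq> S" using R(2) U(8) by auto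
  let ?E = "(UNIV \<times> D) \<inter> (\<lambda>y. \<pi> (?g y)) -` V"
  have E: "open ?E" by (rule preimage_domain_open[OF _ g gS V(1)]) (use U(3) in \<open>auto intro: open_Times\<close>)
  have inv: "inv_into (UNIV \<times> U) (map_prod id \<phi>) (s, x) = (s, \<pi> (\<sigma> x))" if "x \<in> D" for s :: 't and x
  proof (rule inv_into_f_eq)
    show "inj_on (map_prod id \<phi>) (UNIV \<times> U)"
      using chart(3)[OF U(1)] by (auto intro: map_prod_inj_on)
    show "(s, \<pi> (\<sigma> x)) \<in> UNIV \<times> U" "map_prod id \<phi> (s, \<pi> (\<sigma> x)) = (s, x)"
      using that U(5,9) by (auto simp: inv_into_into f_inv_into_f subset_iff)
  qed
  have "smooth_on ?E (\<lambda>y. \<psi> (\<pi> (?g y)))"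
    by (rule smooth_on_compose[OF smooth_on_subset[OF g] chart_projection_smooth[OF V(1)]])
      (use gS in auto)
  then have "smooth_on ?E (\<lambda>y. \<psi> ((\<lambda>(t, p). \<rho> t p) (inv_into (UNIV \<times> U) (map_prod id \<phi>) y)))"
    by (rule smooth_on_cong) (use inv \<rho> U(8) in auto)
  moreover have "(\<lambda>(t, p). \<rho> t p) (inv_into (UNIV \<times> U) (map_prod id \<phi>) y) \<in> V" if "y \<in> ?E" for y
    using that inv \<rho> U(8) by auto
  moreover have "?E \<subseteq> map_prod id \<phi> ` (UNIV \<times> U)"
    using U(5) by (auto simp: map_prod_surj_on)
  moreover have "map_prod id \<phi> q \<in> ?E" "q \<in> UNIV \<times> U"
    using q U(2,4,7) V(2) by auto
  moreover have "(UNIV \<times> U, map_prod id \<phi>) \<in> prod_atlas (euclidean_atlas (UNIV :: 't set)) A"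
    using U(1) by (auto simp: prod_atlas_def euclidean_atlas_def)
  ultimately show "\<exists>(U, \<phi>)\<in>prod_atlas (euclidean_atlas UNIV) A. \<exists>(V, \<psi>)\<in>A. \<exists>D. q \<in> U \<and> open D \<and>
      \<phi> q \<in> D \<and> D \<subseteq> \<phi> ` U \<and> (\<forall>x\<in>D. (\<lambda>(t, p). \<rho> t p) (inv_into U \<phi> x) \<in> V) \<and>
      smooth_on D (\<lambda>x. \<psi> ((\<lambda>(t, p). \<rho> t p) (inv_into U \<phi> x)))"
    using E V(1) by (intro bexI[where x = "(UNIV \<times> U, map_prod id \<phi>)"] case_prodI
        bexI[where x = "(V, \<psi>)"] exI[of _ ?E] conjI) auto
qed

text \<open>
  Smoothness of a curve refers to some chart around its starting point. Smooth transition maps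
  move it to any other chart, which is needed because a local section comes with its own chart.
\<close>

lemma smooth_curve_in_chart:
  assumes "smooth_curve A c" "(U, \<phi>) \<in> A" "c 0 \<in> U"
  obtains e where "e > 0" "c ` {-e<..<e} \<subseteq> U" "smooth_on {-e<..<e} (\<lambda>t. \<phi> (c t))"
proof -
  obtain e where e: "e > 0" "smooth_map (euclidean_atlas {-e<..<e}) A c"
    using assms(1) unfolding smooth_curve_def by blast
  have "0 \<in> atlas_carrier (euclidean_atlas {-e<..<e})"
    using e(1) by (simp add: atlas_carrier_def euclidean_atlas_def)
  then obtain V \<psi> D where V: "(V, \<psi>) \<in> A" "open D" "0 \<in> D" "D \<subseteq> {-e<..<e}"
      "\<forall>t\<in>D. c (inv_into {-e<..<e} id t) \<in> V"
      "smooth_on D (\<lambda>t. \<psi> (c (inv_into {-e<..<e} id t)))"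
    using e(2) unfolding smooth_map_def by (force simp: euclidean_atlas_def)
  have cV: "c t \<in> V" if "t \<in> D" for t using V(4,5) that inv_into_id by (metis subsetD)
  have s: "smooth_on D (\<lambda>t. \<psi> (c t))"
    using V(6) by (rule smooth_on_cong) (use V(4) inv_into_id in \<open>metis subsetD\<close>)
  have "openin (quotient_topology S \<pi>) (V \<inter> U)"
    using chart(1)[OF V(1)] chart(1)[OF assms(2)] by (rule openin_Int)
  then have "openin (subtopology (quotient_topology S \<pi>) V) (V \<inter> U)"
    using chart(1)[OF V(1)] by (simp add: openin_open_subtopology)
  then have "openin (top_of_set (\<psi> ` V)) (\<psi> ` (V \<inter> U))"
    using homeomorphic_imp_open_map[OF chart(5)[OF V(1)]] by (auto simp: open_map_def)
  then have "open (\<psi> ` (V \<inter> U))"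
    using chart(2)[OF V(1)] openin_open_trans by blast
  then have "open (D \<inter> (\<lambda>t. \<psi> (c t)) -` (\<psi> ` (V \<inter> U)))" (is "open ?E")
    using smooth_on_continuous[OF s] V(2) by (simp add: continuous_on_open_vimage Int_commute)
  moreover have "0 \<in> ?E" using V(3) cV assms(3) by auto
  ultimately obtain d where d: "d > 0" "ball 0 d \<subseteq> ?E" by (meson openE)
  then have dE: "{-d<..<d} \<subseteq> ?E" by (auto simp: ball_eq_greaterThanLessThan)
  have cU: "c t \<in> U" if "t \<in> ?E" for t
    using that cV inj_onD[OF chart(3)[OF V(1)]] by auto
  have "smooth_on (\<psi> ` (V \<inter> U)) (\<phi> \<circ> inv_into V \<psi>)"
    using manifold V(1) assms(2) unfolding smooth_manifold_def by fast
  then have "smooth_on ?E (\<lambda>t. (\<phi> \<circ> inv_into V \<psi>) (\<psi> (c t)))"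
    by (rule smooth_on_compose[OF smooth_on_subset[OF s, of ?E], rotated]) auto
  then have "smooth_on ?E (\<lambda>t. \<phi> (c t))"
    by (rule smooth_on_cong) (use cV chart(3)[OF V(1)] in auto)
  then show ?thesis
    using that[OF d(1)] dE cU smooth_on_subset by blast
qed

lemma smooth_curve_project:
  assumes "e > 0" "smooth_on {-e<..<e} \<gamma>" "\<gamma> ` {-e<..<e} \<subseteq> S"
  shows "smooth_curve A (\<lambda>t. \<pi> (\<gamma> t))"
  unfolding smooth_curve_def using assms(1) smooth_map_project[OF open_greaterThanLessThan assms(2,3)]
  by (intro exI[of _ e] conjI)

lemma velocity_project_in_tangent_space:
  assumes "e > 0" "smooth_on {-e<..<e} \<gamma>" "\<gamma> ` {-e<..<e} \<subseteq> S"
  shows "velocity A (\<lambda>t. \<pi> (\<gamma> t)) \<in> tangent_space A (\<pi> (\<gamma> 0))"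
  using smooth_curve_project[OF assms] unfolding tangent_space_def by blast

text \<open>
  Applying the local section through \<open>z\<close> to a curve in the quotient lifts the curve to \<open>S\<close>.
  As the value of a pulled back form is known on curves in \<open>S\<close> only, this is what makes the form on
  the quotient computable.
\<close>

lemma tangent_vector_lift:
  assumes "z \<in> S" "X \<in> tangent_space A (\<pi> z)"
  obtains e \<gamma> where "e > 0" "smooth_on {-e<..<e} \<gamma>" "\<gamma> ` {-e<..<e} \<subseteq> S" "\<gamma> 0 = z"
    "X = velocity A (\<lambda>t. \<pi> (\<gamma> t))"
proof -
  obtain c where c: "smooth_curve A c" "c 0 = \<pi> z" "X = velocity A c"
    using assms(2) unfolding tangent_space_def by blast
  obtain U \<phi> D \<sigma> where U: "(U, \<phi>) \<in> A" "\<pi> z \<in> U" "open D" "\<phi> (\<pi> z) \<in> D" "D \<subseteq> \<phi> ` U"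
    "smooth_on D \<sigma>" "\<sigma> (\<phi> (\<pi> z)) = z" "\<forall>x\<in>D. \<sigma> x \<in> S" "\<forall>x\<in>D. \<pi> (\<sigma> x) = inv_into U \<phi> x"
    using local_section[OF assms(1)] by (elim exE conjE) (rule that)
  obtain e where e: "e > 0" "c ` {-e<..<e} \<subseteq> U" "smooth_on {-e<..<e} (\<lambda>t. \<phi> (c t))"
    using c(2) U(2) by (auto intro: smooth_curve_in_chart[OF c(1) U(1)])
  have "open ({-e<..<e} \<inter> (\<lambda>t. \<phi> (c t)) -` D)" (is "open ?E")
    using smooth_on_continuous[OF e(3)] U(3) by (simp add: continuous_on_open_vimage Int_commute)
  moreover have "0 \<in> ?E" using e(1) c(2) U(4) by simp
  ultimately obtain d where d: "d > 0" "ball 0 d \<subseteq> ?E" by (meson openE)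
  then have dE: "{-d<..<d} \<subseteq> ?E" by (auto simp: ball_eq_greaterThanLessThan)
  show ?thesis
  proof (rule that[of d "\<lambda>t. \<sigma> (\<phi> (c t))"])
    show "smooth_on {-d<..<d} (\<lambda>t. \<sigma> (\<phi> (c t)))"
      by (rule smooth_on_compose[OF smooth_on_subset[OF e(3)] U(6)]) (use dE in auto)
    show "(\<lambda>t. \<sigma> (\<phi> (c t))) ` {-d<..<d} \<subseteq> S" using dE U(8) by auto
    have "c t = \<pi> (\<sigma> (\<phi> (c t)))" if "\<bar>t\<bar> < d" for t
    proof -
      have "t \<in> {-d<..<d}" using that by auto
      then have "t \<in> ?E" using dE by (rule rev_subsetD)
      then show ?thesis using U(9) e(2) chart(3)[OF U(1)] by (auto simp: image_subset_iff)
    qed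
    then show "X = velocity A (\<lambda>t. \<pi> (\<sigma> (\<phi> (c t))))"
      unfolding c(3) by (rule velocity_cong_near_0[OF d(1)])
  qed (use d c U in auto)
qed

text \<open>
  In a chart, a tangent vector evaluates \<open>f\<close> by the derivative of the coordinate expression of
  \<open>f\<close> in a fixed direction. Linearity in the direction turns a difference of tangent vectors into
  the velocity of the straight coordinate line in the direction of the difference.
\<close>

lemma tangent_vector_diff:
  assumes "z \<in> S" "X \<in> tangent_space A (\<pi> z)" "Y \<in> tangent_space A (\<pi> z)"
  shows "(\<lambda>f. 1 * X f + (- 1) * Y f) \<in> tangent_space A (\<pi> z)"
proof -
  obtain U \<phi> D \<sigma> where U: "(U, \<phi>) \<in> A" "\<pi> z \<in> U" "open D" "\<phi> (\<pi> z) \<in> D" "D \<subseteq> \<phi> ` U"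
    "smooth_on D \<sigma>" "\<sigma> (\<phi> (\<pi> z)) = z" "\<forall>x\<in>D. \<sigma> x \<in> S" "\<forall>x\<in>D. \<pi> (\<sigma> x) = inv_into U \<phi> x"
    using local_section[OF assms(1)] by (elim exE conjE) (rule that)
  let ?x = "\<phi> (\<pi> z)"
  have gd: "((\<lambda>x. f (\<pi> (\<sigma> x))) has_derivative frechet_derivative (\<lambda>x. f (\<pi> (\<sigma> x))) (at ?x)) (at ?x)"
    if "f \<in> smooth_functions A" for f
  proof -
    have "smooth_on D (\<lambda>x. f (\<pi> (\<sigma> x)))"
      by (rule smooth_on_compose[OF U(6)]) (use that U(8) in \<open>auto simp: smooth_functions_iff\<close>)
    then show ?thesis
      using smooth_on_differentiable[OF _ U(3,4)] by (simp add: frechet_derivative_works)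
  qed
  have along: "deriv (\<lambda>t. f (\<pi> (\<sigma> (k t)))) 0 = frechet_derivative (\<lambda>x. f (\<pi> (\<sigma> x))) (at ?x) u"
    if f: "f \<in> smooth_functions A" and k: "(k has_vector_derivative u) (at 0)" "k 0 = ?x" for f k u
  proof -
    have "((\<lambda>t. f (\<pi> (\<sigma> (k t)))) has_derivative
        (\<lambda>t. frechet_derivative (\<lambda>x. f (\<pi> (\<sigma> x))) (at ?x) (t *\<^sub>R u))) (at 0)"
      using has_derivative_compose[OF k(1)[unfolded has_vector_derivative_def]] gd[OF f] k(2) by simp
    also have "(\<lambda>t. frechet_derivative (\<lambda>x. f (\<pi> (\<sigma> x))) (at ?x) (t *\<^sub>R u)) =
        (*) (frechet_derivative (\<lambda>x. f (\<pi> (\<sigma> x))) (at ?x) u)"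
      using linear_cmul[OF has_derivative_linear[OF gd[OF f]]] by (auto simp: fun_eq_iff)
    finally show ?thesis by (intro DERIV_imp_deriv) (simp add: has_field_derivative_def)
  qed
  have rep: "\<exists>u. \<forall>f\<in>smooth_functions A. Z f = frechet_derivative (\<lambda>x. f (\<pi> (\<sigma> x))) (at ?x) u"
    if Z: "Z \<in> tangent_space A (\<pi> z)" for Z
  proof -
    obtain c where c: "smooth_curve A c" "c 0 = \<pi> z" "Z = velocity A c"
      using Z unfolding tangent_space_def by blast
    obtain e where e: "e > 0" "c ` {-e<..<e} \<subseteq> U" "smooth_on {-e<..<e} (\<lambda>t. \<phi> (c t))"
      using c(2) U(2) by (auto intro: smooth_curve_in_chart[OF c(1) U(1)])
    have "(\<lambda>t. \<phi> (c t)) differentiable (at 0)"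
      using smooth_on_differentiable[OF e(3)] e(1) by simp
    then obtain u where u: "((\<lambda>t. \<phi> (c t)) has_vector_derivative u) (at 0)"
      using vector_derivative_works by blast
    have "open ({-e<..<e} \<inter> (\<lambda>t. \<phi> (c t)) -` D)" (is "open ?E")
      using smooth_on_continuous[OF e(3)] U(3) by (simp add: continuous_on_open_vimage Int_commute)
    moreover have "0 \<in> ?E" using e(1) c(2) U(4) by simp
    moreover have "c t = \<pi> (\<sigma> (\<phi> (c t)))" if "t \<in> ?E" for t
      using that U(9) e(2) chart(3)[OF U(1)] by (auto simp: image_subset_iff)
    ultimately have ev: "\<forall>\<^sub>F t in nhds 0. f (c t) = f (\<pi> (\<sigma> (\<phi> (c t))))" for f :: "'m \<Rightarrow> real"
      unfolding eventually_nhds by metis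
    have "Z f = frechet_derivative (\<lambda>x. f (\<pi> (\<sigma> x))) (at ?x) u" if "f \<in> smooth_functions A" for f
      using deriv_cong_ev[OF ev[of f] refl] along[OF that u] c that by (simp add: velocity_def)
    then show ?thesis by blast
  qed
  obtain u v where u: "\<And>f. f \<in> smooth_functions A \<Longrightarrow> X f = frechet_derivative (\<lambda>x. f (\<pi> (\<sigma> x))) (at ?x) u"
    and v: "\<And>f. f \<in> smooth_functions A \<Longrightarrow> Y f = frechet_derivative (\<lambda>x. f (\<pi> (\<sigma> x))) (at ?x) v"
    using rep[OF assms(2)] rep[OF assms(3)] by blast
  let ?k = "\<lambda>t. ?x + t *\<^sub>R (u - v)"
  have "open ((UNIV :: real set) \<inter> ?k -` D)"
    using continuous_on_open_vimage[of UNIV ?k] U(3) by (auto intro!: continuous_intros)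
  moreover have "0 \<in> UNIV \<inter> ?k -` D" using U(4) by simp
  ultimately obtain d where d: "d > 0" "ball 0 d \<subseteq> UNIV \<inter> ?k -` D" by (meson openE)
  then have dD: "?k ` {-d<..<d} \<subseteq> D" by (auto simp: ball_eq_greaterThanLessThan)
  have sk: "smooth_on {-d<..<d} ?k"
    by (rule smooth_onI_Ck[of UNIV])
      (auto intro: Ck_on_add[OF open_UNIV Ck_on_const Ck_on_linear[OF open_UNIV bounded_linear_scaleR_left]])
  have "velocity A (\<lambda>t. \<pi> (\<sigma> (?k t))) \<in> tangent_space A (\<pi> (\<sigma> (?k 0)))"
    by (rule velocity_project_in_tangent_space[OF d(1) smooth_on_compose[OF sk U(6) dD]])
      (use dD U(8) in auto)
  moreover have "velocity A (\<lambda>t. \<pi> (\<sigma> (?k t))) = (\<lambda>f. 1 * X f + (- 1) * Y f)"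
  proof
    fix f
    have k: "(?k has_vector_derivative (u - v)) (at 0)" by (auto intro!: derivative_eq_intros)
    show "velocity A (\<lambda>t. \<pi> (\<sigma> (?k t))) f = 1 * X f + (- 1) * Y f"
    proof (cases "f \<in> smooth_functions A")
      case True
      then show ?thesis
        using along[OF True k] u[OF True] v[OF True] linear_diff[OF has_derivative_linear[OF gd[OF True]]]
        by (simp add: velocity_def)
    next
      case False
      have z: "Z f = 0" if "Z \<in> tangent_space A (\<pi> z)" for Z
        using that False by (auto simp: tangent_space_def velocity_def)
      then show ?thesis using z[OF assms(2)] z[OF assms(3)] False by (simp add: velocity_def)
    qed
  qed
  ultimately show ?thesis using U(7) by simp
qed

text \<open>
  A push-forward is zero, by convention, on functions that are not smooth. The point is
  therefore that \<open>f \<circ> \<rho>\<close> is smooth whenever \<open>f\<close> is, and this can be seen on \<open>S\<close>.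
\<close>

lemma pushforward_velocity:
  assumes "smooth_on S g" "g ` S \<subseteq> S" "\<And>z. z \<in> S \<Longrightarrow> \<rho> (\<pi> z) = \<pi> (g z)"
    and "\<gamma> ` {-e<..<e} \<subseteq> S" "e > 0"
  shows "pushforward A A \<rho> (velocity A (\<lambda>t. \<pi> (\<gamma> t))) = velocity A (\<lambda>t. \<pi> (g (\<gamma> t)))"
proof
  fix f
  show "pushforward A A \<rho> (velocity A (\<lambda>t. \<pi> (\<gamma> t))) f = velocity A (\<lambda>t. \<pi> (g (\<gamma> t))) f"
  proof (cases "f \<in> smooth_functions A")
    case True
    then have "smooth_on S (\<lambda>z. f (\<pi> (g z)))"
      unfolding smooth_functions_iff using smooth_on_compose[OF assms(1) _ assms(2)] by auto
    then have "smooth_on S (\<lambda>z. (f \<circ> \<rho>) (\<pi> z))" by (rule smooth_on_cong) (simp add: assms(3))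
    then have "f \<circ> \<rho> \<in> smooth_functions A" by (simp add: smooth_functions_iff)
    moreover have "\<forall>\<^sub>F t in nhds 0. (f \<circ> \<rho>) (\<pi> (\<gamma> t)) = f (\<pi> (g (\<gamma> t)))"
      unfolding eventually_nhds_metric using assms(3,4,5)
      by (intro exI[of _ e]) (auto simp: abs_less_iff image_subset_iff)
    then have "deriv (\<lambda>t. (f \<circ> \<rho>) (\<pi> (\<gamma> t))) 0 = deriv (\<lambda>t. f (\<pi> (g (\<gamma> t)))) 0"
      by (rule deriv_cong_ev) simp
    ultimately show ?thesis using True by (simp add: pushforward_def velocity_def)
  qed (simp add: pushforward_def velocity_def)
qed

end

section \<open>Two-forms pulled back to a constant form\<close>

locale reduced_form = smooth_quotient S \<pi> A
  for S :: "'a::euclidean_space set" and \<pi> :: "'a \<Rightarrow> 'm" and A :: "('m, 'e::euclidean_space) atlas" +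
  fixes \<omega> :: "'m two_form" and \<Omega> :: "'a \<Rightarrow> 'a \<Rightarrow> real"
  assumes two_form: "smooth_two_form A \<omega>"
    and nondegenerate: "nondegenerate A \<omega>"
    and pullback: "pullback_agrees S A \<pi> \<omega> \<Omega>"
begin

lemma form_on_velocities:
  assumes "d > 0" "smooth_on {-d<..<d} \<gamma>" "\<gamma> ` {-d<..<d} \<subseteq> S"
    and "e > 0" "smooth_on {-e<..<e} \<delta>" "\<delta> ` {-e<..<e} \<subseteq> S" and "\<gamma> 0 = \<delta> 0"
  shows "\<omega> (\<pi> (\<gamma> 0)) (velocity A (\<lambda>t. \<pi> (\<gamma> t))) (velocity A (\<lambda>t. \<pi> (\<delta> t))) =
    \<Omega> (vector_derivative \<gamma> (at 0)) (vector_derivative \<delta> (at 0))"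
proof -
  have "{- min d e<..<min d e} \<subseteq> {-d<..<d}" "{- min d e<..<min d e} \<subseteq> {-e<..<e}" by auto
  then have "min d e > 0 \<and> smooth_on {- min d e<..<min d e} \<gamma> \<and> smooth_on {- min d e<..<min d e} \<delta> \<and>
      \<gamma> ` {- min d e<..<min d e} \<subseteq> S \<and> \<delta> ` {- min d e<..<min d e} \<subseteq> S \<and> \<gamma> 0 = \<delta> 0"
    using assms by (meson image_mono min_less_iff_conj order_trans smooth_on_subset)
  then show ?thesis using pullback unfolding pullback_agrees_def by blast
qed

text \<open>
  Two solutions of \<open>\<omega>(X, \<cdot>) = df\<close> differ by a tangent vector in the kernel of \<open>\<omega>\<close>, and
  nondegeneracy makes that difference vanish. Hence any solution is the
  Hamiltonian vector field.
\<close>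

lemma hamiltonian_vector_field_eqI:
  assumes p: "p \<in> atlas_carrier A" and X: "X \<in> tangent_space A p"
    and eq: "\<And>Y. Y \<in> tangent_space A p \<Longrightarrow> \<omega> p X Y = Y f"
  shows "hamiltonian_vector_field A \<omega> f p = X"
  unfolding hamiltonian_vector_field_def
proof (rule the_equality)
  fix X' assume X': "X' \<in> tangent_space A p \<and> (\<forall>Y\<in>tangent_space A p. \<omega> p X' Y = Y f)"
  let ?Z = "\<lambda>f. 1 * X' f + (- 1) * X f"
  have Z: "?Z \<in> tangent_space A p"
    using p X X' tangent_vector_diff by (auto simp only: carrier_eq)
  have "\<omega> p ?Z Y = 1 * \<omega> p X' Y + (- 1) * \<omega> p X Y" if "Y \<in> tangent_space A p" for Y
    using two_form p X X' that unfolding smooth_two_form_def by blast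
  then have "\<omega> p ?Z Y = 0" if "Y \<in> tangent_space A p" for Y
    using that X' eq by simp
  then have "?Z = (\<lambda>_. 0)"
    using nondegenerate p Z unfolding nondegenerate_def by blast
  then show "X' = X" by (auto simp: fun_eq_iff)
qed (use X eq in auto)

text \<open>
  After lifting both vectors to curves through the same point of \<open>S\<close>, the assertion is the
  invariance of \<open>\<Omega>\<close> under \<open>g\<close>, since a linear map commutes with the derivative of a curve.
\<close>

lemma linear_symmetry_preserves_form:
  assumes g: "bounded_linear g" "g ` S \<subseteq> S" "\<And>u v. \<Omega> (g u) (g v) = \<Omega> u v"
    and \<rho>: "\<And>z. z \<in> S \<Longrightarrow> \<rho> (\<pi> z) = \<pi> (g z)"
    and z: "z \<in> S" and X: "X \<in> tangent_space A (\<pi> z)" and Y: "Y \<in> tangent_space A (\<pi> z)"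
  shows "\<omega> (\<rho> (\<pi> z)) (pushforward A A \<rho> X) (pushforward A A \<rho> Y) = \<omega> (\<pi> z) X Y"
proof -
  obtain d \<gamma> where \<gamma>: "d > 0" "smooth_on {-d<..<d} \<gamma>" "\<gamma> ` {-d<..<d} \<subseteq> S" "\<gamma> 0 = z"
    "X = velocity A (\<lambda>t. \<pi> (\<gamma> t))" by (rule tangent_vector_lift[OF z X]) (rule that)
  obtain e \<delta> where \<delta>: "e > 0" "smooth_on {-e<..<e} \<delta>" "\<delta> ` {-e<..<e} \<subseteq> S" "\<delta> 0 = z"
    "Y = velocity A (\<lambda>t. \<pi> (\<delta> t))" by (rule tangent_vector_lift[OF z Y]) (rule that)
  have g_smooth: "smooth_on T g" for T using g(1) by (rule smooth_on_linear)
  have g_curve: "smooth_on {-r<..<r} (\<lambda>t. g (c t))" "(\<lambda>t. g (c t)) ` {-r<..<r} \<subseteq> S"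
    "vector_derivative (\<lambda>t. g (c t)) (at 0) = g (vector_derivative c (at 0))"
    if c: "r > 0" "smooth_on {-r<..<r} c" "c ` {-r<..<r} \<subseteq> S" for r c
  proof -
    show "smooth_on {-r<..<r} (\<lambda>t. g (c t))"
      by (rule smooth_on_compose[OF c(2) g_smooth subset_UNIV])
    show "(\<lambda>t. g (c t)) ` {-r<..<r} \<subseteq> S" using c(3) g(2) by blast
    have "(c has_vector_derivative vector_derivative c (at 0)) (at 0)"
      using smooth_on_differentiable[OF c(2)] c(1) by (simp add: vector_derivative_works[symmetric])
    then show "vector_derivative (\<lambda>t. g (c t)) (at 0) = g (vector_derivative c (at 0))"
      using bounded_linear.has_vector_derivative[OF g(1)] vector_derivative_at by blast
  qed
  have "\<rho> (\<pi> z) = \<pi> (g (\<gamma> 0))" using \<rho> z \<gamma> by simp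
  moreover have "pushforward A A \<rho> X = velocity A (\<lambda>t. \<pi> (g (\<gamma> t)))"
    using pushforward_velocity[OF g_smooth g(2) \<rho> \<gamma>(3,1)] \<gamma>(5) by simp
  moreover have "pushforward A A \<rho> Y = velocity A (\<lambda>t. \<pi> (g (\<delta> t)))"
    using pushforward_velocity[OF g_smooth g(2) \<rho> \<delta>(3,1)] \<delta>(5) by simp
  ultimately show ?thesis
    using form_on_velocities[OF \<gamma>(1) g_curve(1,2)[OF \<gamma>(1-3)] \<delta>(1) g_curve(1,2)[OF \<delta>(1-3)]]
      form_on_velocities[OF \<gamma>(1-3) \<delta>(1-3)] g_curve(3)[OF \<gamma>(1-3)] g_curve(3)[OF \<delta>(1-3)] \<gamma> \<delta> g(3)
    by simp
qed

text \<open>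
  To verify Hamilton's equation on the quotient it suffices to verify
  \<open>\<Omega>(\<gamma>'(0), \<cdot>) = dh\<close> at one point of the ambient linear space, where \<open>h\<close> may be any
  extension of \<open>f \<circ> \<pi>\<close> off \<open>S\<close>.
\<close>

lemma velocity_dual_to_differential:
  assumes \<gamma>: "d > 0" "smooth_on {-d<..<d} \<gamma>" "\<gamma> ` {-d<..<d} \<subseteq> S" "\<gamma> 0 = z"
    and f: "f \<in> smooth_functions A" "\<And>y. y \<in> S \<Longrightarrow> f (\<pi> y) = h y"
    and h: "(h has_derivative \<Omega> (vector_derivative \<gamma> (at 0))) (at z)"
    and Y: "Y \<in> tangent_space A (\<pi> z)"
  shows "\<omega> (\<pi> z) (velocity A (\<lambda>t. \<pi> (\<gamma> t))) Y = Y f"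
proof -
  have z: "z \<in> S" using \<gamma> by auto
  obtain e \<delta> where \<delta>: "e > 0" "smooth_on {-e<..<e} \<delta>" "\<delta> ` {-e<..<e} \<subseteq> S" "\<delta> 0 = z"
    "Y = velocity A (\<lambda>t. \<pi> (\<delta> t))" by (rule tangent_vector_lift[OF z Y]) (rule that)
  let ?v = "vector_derivative \<delta> (at 0)" and ?\<Omega> = "\<Omega> (vector_derivative \<gamma> (at 0))"
  have "(\<delta> has_vector_derivative ?v) (at 0)"
    using smooth_on_differentiable[OF \<delta>(2)] \<delta>(1) by (simp add: vector_derivative_works[symmetric])
  then have "((\<lambda>t. h (\<delta> t)) has_derivative (\<lambda>t. ?\<Omega> (t *\<^sub>R ?v))) (at 0)"
    using has_derivative_compose[of \<delta> _ 0 UNIV h ?\<Omega>] h \<delta>(4) by (simp add: has_vector_derivative_def)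
  moreover have "(\<lambda>t. ?\<Omega> (t *\<^sub>R ?v)) = (*) (?\<Omega> ?v)"
    using linear_cmul[OF has_derivative_linear[OF h]] by auto
  ultimately have "deriv (\<lambda>t. h (\<delta> t)) 0 = ?\<Omega> ?v"
    by (intro DERIV_imp_deriv) (simp add: has_field_derivative_def)
  moreover have "\<forall>\<^sub>F t in nhds 0. f (\<pi> (\<delta> t)) = h (\<delta> t)"
    unfolding eventually_nhds_metric using f(2) \<delta>(1,3)
    by (intro exI[of _ e]) (auto simp: abs_less_iff image_subset_iff)
  then have "deriv (\<lambda>t. f (\<pi> (\<delta> t))) 0 = deriv (\<lambda>t. h (\<delta> t)) 0" by (rule deriv_cong_ev) simp
  ultimately have "Y f = ?\<Omega> ?v"
    using f(1) \<delta>(5) by (simp add: velocity_def)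
  then show ?thesis
    using form_on_velocities[OF \<gamma>(1-3) \<delta>(1-3)] \<gamma>(4) \<delta>(4,5) by simp
qed

end

section \<open>Rotations of the coordinates\<close>

lemma exhaust_8:
  fixes x :: 8
  shows "x = 1 \<or> x = 2 \<or> x = 3 \<or> x = 4 \<or> x = 5 \<or> x = 6 \<or> x = 7 \<or> x = 8"
proof (induct x)
  case (of_int z)
  then have "z = 0 \<or> z = 1 \<or> z = 2 \<or> z = 3 \<or> z = 4 \<or> z = 5 \<or> z = 6 \<or> z = 7" by fastforce
  then show ?case by auto
qed

lemma UNIV_8: "UNIV = {1, 2, 3, 4, 5, 6, 7, 8 :: 8}"
  using exhaust_8 by auto

lemma forall_8: "(\<forall>i::8. P i) \<longleftrightarrow> P 1 \<and> P 2 \<and> P 3 \<and> P 4 \<and> P 5 \<and> P 6 \<and> P 7 \<and> P 8"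
proof -
  have "(\<forall>i::8. P i) \<longleftrightarrow> (\<forall>i\<in>UNIV. P i)" by simp
  also have "\<dots> \<longleftrightarrow> P 1 \<and> P 2 \<and> P 3 \<and> P 4 \<and> P 5 \<and> P 6 \<and> P 7 \<and> P 8" unfolding UNIV_8 by simp
  finally show ?thesis .
qed

lemma sum_8: "sum f (UNIV :: 8 set) = f 1 + f 2 + f 3 + f 4 + f 5 + f 6 + f 7 + f 8"
  unfolding UNIV_8 by (simp add: ac_simps)

lemma vector_8:
  fixes a :: "'a::zero"
  shows "(vector [a, b, c, d, e, f, g, h] :: 'a ^ 8) $ 1 = a"
    "(vector [a, b, c, d, e, f, g, h] :: 'a ^ 8) $ 2 = b"
    "(vector [a, b, c, d, e, f, g, h] :: 'a ^ 8) $ 3 = c"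
    "(vector [a, b, c, d, e, f, g, h] :: 'a ^ 8) $ 4 = d"
    "(vector [a, b, c, d, e, f, g, h] :: 'a ^ 8) $ 5 = e"
    "(vector [a, b, c, d, e, f, g, h] :: 'a ^ 8) $ 6 = f"
    "(vector [a, b, c, d, e, f, g, h] :: 'a ^ 8) $ 7 = g"
    "(vector [a, b, c, d, e, f, g, h] :: 'a ^ 8) $ 8 = h"
  unfolding vector_def by simp_all

text \<open>
  The standard action of the full eight-dimensional torus. Both \<open>N\<close> and the residual actions
  on the quotient are restrictions of it along linear maps of Lie algebras, so that they commute and
  all their properties follow from those of \<open>rot\<close>.
\<close>

definition rot :: "real ^ 8 \<Rightarrow> complex ^ 8 \<Rightarrow> complex ^ 8" where
  "rot \<theta> z = (\<chi> k. cis (\<theta> $ k) * z $ k)"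

lemma rot_nth [simp]: "rot \<theta> z $ k = cis (\<theta> $ k) * z $ k"
  by (simp add: rot_def)

lemma rot_zero [simp]: "rot 0 z = z"
  by (simp add: vec_eq_iff)

lemma rot_add: "rot (\<theta> + \<eta>) z = rot \<theta> (rot \<eta> z)"
  by (simp add: vec_eq_iff cis_mult[symmetric] mult.assoc)

lemma rot_in_W [simp]: "rot \<theta> z \<in> W \<longleftrightarrow> z \<in> W"
  by (simp add: W_def norm_mult)

definition N_weights :: "real ^ 6 \<Rightarrow> real ^ 8" where
  "N_weights t = vector [t $ 1, t $ 2, t $ 3, t $ 4, t $ 1 + t $ 2 - t $ 4 - t $ 5 + t $ 6, t $ 5,
     t $ 2 + t $ 3 + t $ 4 - t $ 5 - t $ 6, t $ 6]"

lemma N_act_eq_rot: "N_act t z = rot (N_weights t) z"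
  by (simp add: N_act_def N_weights_def vec_eq_iff forall_8 vector_8)

lemma N_act_rot: "N_act t (rot \<theta> z) = rot \<theta> (N_act t z)"
  by (metis N_act_eq_rot add.commute rot_add)

lemma norm_on_orbit: "w \<in> \<tau> z \<Longrightarrow> cmod (w $ k) = cmod (z $ k)"
  by (auto simp: \<tau>_def N_act_eq_rot norm_mult)

lemma self_in_orbit: "z \<in> \<tau> z"
proof -
  have "N_weights 0 = 0" by (simp add: N_weights_def vec_eq_iff forall_8 vector_8)
  then have "z = N_act 0 z" by (simp add: N_act_eq_rot)
  then show ?thesis unfolding \<tau>_def by (rule range_eqI)
qed

text \<open>
  The rotations commute with \<open>N\<close>, hence permute its orbits. Taking the direct image of an orbit
  therefore defines the induced action on the quotient without choosing representatives.
\<close>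

lemma rot_image_orbit: "rot \<theta> ` \<tau> z = \<tau> (rot \<theta> z)"
  by (simp add: \<tau>_def image_image N_act_rot)

lemma the_norm_on_orbit: "(THE r. \<forall>w\<in>\<tau> z. r = 1/2 * (cmod (w $ k))\<^sup>2) = 1/2 * (cmod (z $ k))\<^sup>2"
proof (rule the_equality)
  show "\<forall>w\<in>\<tau> z. 1/2 * (cmod (z $ k))\<^sup>2 = 1/2 * (cmod (w $ k))\<^sup>2"
    using norm_on_orbit[of _ z k] by simp
qed (use self_in_orbit[of z] in blast)

lemma J_\<tau>: "J (\<tau> z) = 1/2 * (cmod (z $ 1))\<^sup>2"
  unfolding J_def by (rule the_norm_on_orbit)

lemma H_\<tau>: "H (\<tau> z) = 1/2 * (cmod (z $ 3))\<^sup>2"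
  unfolding H_def by (rule the_norm_on_orbit)

lemma bounded_linear_axis: "bounded_linear (axis k :: 'a::euclidean_space \<Rightarrow> 'a ^ 'n)"
  by (intro linear_conv_bounded_linear[THEN iffD1] linearI) (auto simp: vec_eq_iff axis_def)

lemma vec_eq_sum_axis: "(x :: 'a::comm_monoid_add ^ 'n) = (\<Sum>k\<in>UNIV. axis k (x $ k))"
  by (simp add: vec_eq_iff axis_def sum_component)

text \<open>
  As a finite sum of linear images, vector-valued rotations inherit smoothness and derivatives
  from their complex components.
\<close>

lemma rot_eq_sum: "rot \<theta> z = (\<Sum>k\<in>UNIV. axis k (cis (\<theta> $ k) * z $ k))"
  by (subst vec_eq_sum_axis) simp

lemma smooth_on_rot: "smooth_on T (\<lambda>(\<theta>, z). rot \<theta> z)"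
proof (rule smooth_onI_Ck[OF open_UNIV subset_UNIV])
  fix n
  have "Ck_on n UNIV (\<lambda>p. cis (fst p $ k))" for k :: 8
    by (rule Ck_on_compose[OF open_UNIV open_UNIV subset_UNIV _ Ck_on_cis])
      (rule Ck_on_linear[OF open_UNIV bounded_linear_compose[OF bounded_linear_vec_nth bounded_linear_fst]])
  moreover have "Ck_on n UNIV (\<lambda>p. snd p $ k)" for k :: 8
    by (rule Ck_on_linear[OF open_UNIV bounded_linear_compose[OF bounded_linear_vec_nth bounded_linear_snd]])
  ultimately have "Ck_on n UNIV (\<lambda>p. \<Sum>k\<in>UNIV. axis k (cis (fst p $ k) * snd p $ k) :: complex ^ 8)"
    by (intro Ck_on_sum open_UNIV finite Ck_on_bounded_linear[OF _ bounded_linear_axis]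
      Ck_on_bounded_bilinear[OF _ bounded_bilinear_mult])
  then show "Ck_on n UNIV (\<lambda>(\<theta>, z). rot \<theta> z)"
    by (simp add: rot_eq_sum case_prod_unfold)
qed

lemma bounded_linear_rot: "bounded_linear (rot \<theta>)"
  by (intro linear_conv_bounded_linear[THEN iffD1] linearI) (auto simp: vec_eq_iff algebra_simps)

text \<open>
  In each coordinate the form is the oriented area in the plane, and rotations have determinant
  \<open>(cos \<alpha>)\<^sup>2 + (sin \<alpha>)\<^sup>2 = 1\<close>.
\<close>

lemma omega_st_rot: "omega_st (rot \<theta> u) (rot \<theta> v) = omega_st u v"
proof -
  have "(c * p - s * q) * (c * q' + s * p') - (c * q + s * p) * (c * p' - s * q') = p * q' - q * p'"
    if "c\<^sup>2 + s\<^sup>2 = 1" for c s p q p' q' :: real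
    using that by algebra
  from this[OF sin_cos_squared_add2]
  show ?thesis by (simp add: omega_st_def)
qed

text \<open>
  The momentum function of the rotation in direction \<open>\<theta>\<close>. The convention
  \<open>\<omega>(X, \<cdot>) = df\<close> with \<open>\<omega> = dx \<and> dy\<close> forces the minus sign: \<open>\<bar>z\<bar>\<^sup>2 / 2\<close> generates the
  clockwise rotation.
\<close>

definition rot_momentum :: "real ^ 8 \<Rightarrow> complex ^ 8 \<Rightarrow> real" where
  "rot_momentum \<theta> z = - (\<Sum>k\<in>UNIV. \<theta> $ k * (z $ k \<bullet> z $ k)) / 2"

lemma smooth_on_rot_momentum: "smooth_on T (rot_momentum \<theta>)"
proof (rule smooth_onI_Ck[OF open_UNIV subset_UNIV])
  fix n
  have z: "Ck_on n UNIV (\<lambda>z :: complex ^ 8. z $ k)" for k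
    by (rule Ck_on_linear[OF open_UNIV bounded_linear_vec_nth])
  have "Ck_on n UNIV (\<lambda>z :: complex ^ 8. \<Sum>k\<in>UNIV. (- \<theta> $ k / 2) * (z $ k \<bullet> z $ k))"
    by (intro Ck_on_sum open_UNIV finite Ck_on_bounded_linear[OF _ bounded_linear_mult_right]
        Ck_on_bounded_bilinear[OF _ bounded_bilinear_inner] z)
  moreover have "rot_momentum \<theta> = (\<lambda>z. \<Sum>k\<in>UNIV. (- \<theta> $ k / 2) * (z $ k \<bullet> z $ k))"
    by (simp add: rot_momentum_def fun_eq_iff sum_negf sum_divide_distrib)
  ultimately show "Ck_on n UNIV (rot_momentum \<theta>)" by simp
qed

lemma rot_velocity:
  "((\<lambda>s. rot (s *\<^sub>R \<theta>) z) has_vector_derivative (\<chi> k. \<i> * \<theta> $ k * z $ k)) (at 0)"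
proof -
  have "((\<lambda>s. cis (s * \<theta> $ k) * z $ k) has_vector_derivative (\<i> * \<theta> $ k * z $ k)) (at 0)" for k
    unfolding has_vector_derivative_def
    by (rule derivative_eq_intros refl | simp add: fun_eq_iff scaleR_conv_of_real)+
  then have "((\<lambda>s. \<Sum>k\<in>UNIV. axis k (cis (s * \<theta> $ k) * z $ k)) has_vector_derivative
      (\<Sum>k\<in>UNIV. axis k (\<i> * \<theta> $ k * z $ k))) (at 0)"
    by (intro has_vector_derivative_sum bounded_linear.has_vector_derivative[OF bounded_linear_axis])
  moreover have "(\<Sum>k\<in>UNIV. axis k (\<i> * \<theta> $ k * z $ k)) = (\<chi> k. \<i> * \<theta> $ k * z $ k)"
    by (subst (2) vec_eq_sum_axis) simp
  ultimately show ?thesis by (simp add: rot_eq_sum)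
qed

text \<open>
  Hamilton's equation on \<open>C^8\<close>: the constant form contracted with the fundamental vector
  \<open>(i \<theta>\<^sub>k z\<^sub>k)\<^sub>k\<close> is the differential of the momentum function.
\<close>

lemma rot_momentum_derivative:
  "(rot_momentum \<theta> has_derivative omega_st (\<chi> k. \<i> * \<theta> $ k * z $ k)) (at z)"
proof -
  have "((\<lambda>z. \<theta> $ k * (z $ k \<bullet> z $ k)) has_derivative (\<lambda>v. 2 * \<theta> $ k * (z $ k \<bullet> v $ k))) (at z)" for k
    by (rule derivative_eq_intros refl bounded_linear.has_derivative[OF bounded_linear_vec_nth] |
        simp add: fun_eq_iff inner_commute)+
  then have "(rot_momentum \<theta> has_derivative (\<lambda>v. - (\<Sum>k\<in>UNIV. 2 * \<theta> $ k * (z $ k \<bullet> v $ k)) / 2)) (at z)"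
    unfolding rot_momentum_def[abs_def] divide_inverse
    by (intro has_derivative_mult_left has_derivative_minus has_derivative_sum)
  moreover have "(\<lambda>v. - (\<Sum>k\<in>UNIV. 2 * \<theta> $ k * (z $ k \<bullet> v $ k)) / 2) = omega_st (\<chi> k. \<i> * \<theta> $ k * z $ k)"
    unfolding fun_eq_iff omega_st_def sum_divide_distrib sum_negf[symmetric]
    by (intro allI sum.cong refl) (simp add: inner_complex_def field_simps)
  ultimately show ?thesis by simp
qed

section \<open>Residual rotations of the quotient\<close>

locale octagon_manifold = reduced_form W \<tau> A \<omega> omega_st
  for A :: "((complex ^ 8) set, 'e::euclidean_space) atlas" and \<omega>
begin

text \<open>
  An integral linear map \<open>L\<close> is a homomorphism of tori, and restricts the standard action.
\<close>

lemma torus_action_rot: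
  fixes L :: "'t::euclidean_space \<Rightarrow> real ^ 8"
  assumes L: "bounded_linear L"
    and int: "\<And>b k. b \<in> Basis \<Longrightarrow> \<exists>m::int. L b $ k = of_int m"
  shows "torus_action A (\<lambda>t p. rot (L t) ` p)"
  unfolding torus_action_def
proof (intro conjI ballI allI)
  have "smooth_on (UNIV \<times> W) (\<lambda>q. (\<lambda>(\<theta>, z). rot \<theta> z) (L (fst q), snd q))"
    by (rule smooth_on_compose[OF smooth_on_Pair[OF smooth_on_linear smooth_on_linear] smooth_on_rot subset_UNIV])
      (use bounded_linear_compose[OF L bounded_linear_fst] bounded_linear_snd in auto)
  then have "smooth_on (UNIV \<times> W) (\<lambda>(t, z). rot (L t) z)" by (simp add: case_prod_unfold)
  then show "smooth_map (prod_atlas (euclidean_atlas UNIV) A) A (\<lambda>(t, p). rot (L t) ` p)"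
    by (rule smooth_map_prod_descends) (auto simp: rot_image_orbit)
next
  fix p
  show "rot (L 0) ` p = p"
    by (simp add: linear_0[OF bounded_linear.linear[OF L]])
  show "rot (L (s + t)) ` p = rot (L s) ` rot (L t) ` p" for s t
    by (simp add: linear_add[OF bounded_linear.linear[OF L]] rot_add image_image)
  fix b :: 't assume b: "b \<in> Basis"
  have "cis (L ((2 * pi) *\<^sub>R b) $ k) = 1" for k
  proof -
    obtain m :: int where "L b $ k = of_int m" using int[OF b] by blast
    then show ?thesis
      using cis_multiple_2pi[of "of_int m"] by (simp add: linear_cmul[OF bounded_linear.linear[OF L]])
  qed
  then have "rot (L ((2 * pi) *\<^sub>R b)) z = z" for z by (simp add: vec_eq_iff)
  then show "rot (L ((2 * pi) *\<^sub>R b)) ` p = p" by simp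
qed

lemma symplectic_action_rot: "symplectic_action A \<omega> (\<lambda>t p. rot (L t) ` p)"
  unfolding symplectic_action_def carrier_eq
proof (intro allI ballI)
  fix t p X Y
  assume "p \<in> \<tau> ` W" and XY: "X \<in> tangent_space A p" "Y \<in> tangent_space A p"
  then obtain z where z: "z \<in> W" "p = \<tau> z" by blast
  show "\<omega> (rot (L t) ` p) (pushforward A A ((`) (rot (L t))) X) (pushforward A A ((`) (rot (L t))) Y) = \<omega> p X Y"
    using linear_symmetry_preserves_form[OF bounded_linear_rot[of "L t"] _ omega_st_rot rot_image_orbit z(1)] z XY
    by (auto simp: image_subset_iff)
qed

lemma rot_momentum_smooth:
  assumes "\<And>z. z \<in> W \<Longrightarrow> f (\<tau> z) = rot_momentum \<theta> z"
  shows "f \<in> smooth_functions A"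
  unfolding smooth_functions_iff using smooth_on_rot_momentum by (rule smooth_on_cong) (simp add: assms)

lemma rot_hamiltonian:
  assumes f: "\<And>z. z \<in> W \<Longrightarrow> f (\<tau> z) = rot_momentum \<theta> z" and p: "p \<in> atlas_carrier A"
  shows "velocity A (\<lambda>s. rot (s *\<^sub>R \<theta>) ` p) \<in> tangent_space A p"
    and "Y \<in> tangent_space A p \<Longrightarrow> \<omega> p (velocity A (\<lambda>s. rot (s *\<^sub>R \<theta>) ` p)) Y = Y f"
proof -
  obtain z where z: "z \<in> W" "p = \<tau> z" using p by (auto simp: carrier_eq)
  let ?\<gamma> = "\<lambda>s. rot (s *\<^sub>R \<theta>) z"
  have \<gamma>: "smooth_on {-1<..<1} ?\<gamma>" "?\<gamma> ` {-1<..<1} \<subseteq> W"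
  proof -
    have "smooth_on {-1<..<1} (\<lambda>s. (\<lambda>(\<theta>, z). rot \<theta> z) (s *\<^sub>R \<theta>, z))"
      by (rule smooth_on_compose[OF smooth_on_Pair[OF smooth_on_linear[OF bounded_linear_scaleR_left]
            smooth_onI_Ck[OF open_UNIV subset_UNIV Ck_on_const]] smooth_on_rot subset_UNIV])
    then show "smooth_on {-1<..<1} ?\<gamma>" by simp
  qed (use z in auto)
  have eq: "(\<lambda>s. rot (s *\<^sub>R \<theta>) ` p) = (\<lambda>s. \<tau> (?\<gamma> s))" by (simp add: z rot_image_orbit)
  show "velocity A (\<lambda>s. rot (s *\<^sub>R \<theta>) ` p) \<in> tangent_space A p"
    using velocity_project_in_tangent_space[OF _ \<gamma>] z unfolding eq by simp
  have "(rot_momentum \<theta> has_derivative omega_st (vector_derivative ?\<gamma> (at 0))) (at z)"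
    using rot_momentum_derivative by (simp add: vector_derivative_at[OF rot_velocity])
  then show "\<omega> p (velocity A (\<lambda>s. rot (s *\<^sub>R \<theta>) ` p)) Y = Y f" if "Y \<in> tangent_space A p"
    using velocity_dual_to_differential[OF _ \<gamma> _ rot_momentum_smooth[OF f] f] that z unfolding eq by simp
qed

text \<open>
  By the group law the velocity of an orbit at time \<open>t\<close> is the fundamental vector at the point
  reached, which solves Hamilton's equation there.
\<close>

lemma circle_action_rot:
  assumes f: "\<And>z. z \<in> W \<Longrightarrow> f (\<tau> z) = rot_momentum \<theta> z" and int: "\<And>k. \<exists>m::int. \<theta> $ k = of_int m"
  shows "circle_action_of A \<omega> f (\<lambda>t p. rot (t *\<^sub>R \<theta>) ` p)"
  unfolding circle_action_of_def
proof (intro conjI ballI allI)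
  show "torus_action A (\<lambda>t p. rot (t *\<^sub>R \<theta>) ` p)"
    by (rule torus_action_rot[OF bounded_linear_scaleR_left]) (use int in auto)
  fix p and t :: real assume "p \<in> atlas_carrier A"
  then have "rot (t *\<^sub>R \<theta>) ` p \<in> atlas_carrier A" by (auto simp: carrier_eq rot_image_orbit)
  from hamiltonian_vector_field_eqI[OF this rot_hamiltonian[OF f this]]
  show "velocity A (\<lambda>s. rot ((t + s) *\<^sub>R \<theta>) ` p) = hamiltonian_vector_field A \<omega> f (rot (t *\<^sub>R \<theta>) ` p)"
    by (simp add: image_image rot_add[symmetric] scaleR_add_left add.commute)
qed

end

section \<open>The momentum image\<close>

text \<open>
  The half-planes cut out a convex set with all vertices. Conversely, the ordinates \<open>1\<close> and
  \<open>2\<close> divide the octagon into a rectangle between two trapezoids, and in each piece a horizontal line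
  joins points on two edges.
\<close>

lemma octagon_eq:
  "octagon = {v. 0 \<le> v $ 1 \<and> v $ 1 \<le> 3 \<and> 0 \<le> v $ 2 \<and> v $ 2 \<le> 3 \<and> 1 \<le> v $ 1 + v $ 2 \<and>
     v $ 1 + v $ 2 \<le> 5 \<and> v $ 1 - v $ 2 \<le> 2 \<and> v $ 2 - v $ 1 \<le> 2}" (is "_ = ?P")
proof
  have half: "convex {v :: real ^ 2. a * v $ 1 + b * v $ 2 \<le> c}" for a b c
    using convex_halfspace_le[of "vector [a, b] :: real ^ 2" c] by (simp add: inner_vec_def sum_2)
  have "?P = {v. (-1) * v $ 1 + 0 * v $ 2 \<le> 0} \<inter> {v. 1 * v $ 1 + 0 * v $ 2 \<le> 3} \<inter>
      {v. 0 * v $ 1 + (-1) * v $ 2 \<le> 0} \<inter> {v. 0 * v $ 1 + 1 * v $ 2 \<le> 3} \<inter>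
      {v. (-1) * v $ 1 + (-1) * v $ 2 \<le> -1} \<inter> {v. 1 * v $ 1 + 1 * v $ 2 \<le> 5} \<inter>
      {v. 1 * v $ 1 + (-1) * v $ 2 \<le> 2} \<inter> {v. (-1) * v $ 1 + 1 * v $ 2 \<le> 2}" by auto
  moreover have "convex \<dots>" by (intro convex_Int half)
  ultimately have "convex ?P" by simp
  then show "octagon \<subseteq> ?P" unfolding octagon_def by (intro hull_minimal) auto
next
  have seg: "vector [a + u * (c - a), b + u * (d - b)] \<in> octagon"
    if "vector [a, b] \<in> octagon" "vector [c, d] \<in> octagon" "0 \<le> u" "u \<le> 1" for a b c d u :: real
  proof -
    have "(1 - u) *\<^sub>R vector [a, b] + u *\<^sub>R vector [c, d] \<in> octagon"
      using that convex_convex_hull unfolding octagon_def by (intro convexD_alt) auto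
    moreover have "(1 - u) *\<^sub>R vector [a, b] + u *\<^sub>R vector [c, d] =
        (vector [a + u * (c - a), b + u * (d - b)] :: real ^ 2)"
      by (simp add: vec_eq_iff forall_2 algebra_simps)
    ultimately show ?thesis by simp
  qed
  have vertex: "vector [0, 2] \<in> octagon" "vector [0, 1] \<in> octagon" "vector [1, 0] \<in> octagon"
    "vector [2, 0] \<in> octagon" "vector [3, 1] \<in> octagon" "vector [3, 2] \<in> octagon"
    "vector [2, 3] \<in> octagon" "vector [1, 3] \<in> octagon"
    unfolding octagon_def by (auto intro!: hull_inc)
  have row: "vector [x, y] \<in> octagon"
    if "vector [a, y] \<in> octagon" "vector [b, y] \<in> octagon" "a \<le> x" "x \<le> b" "a < b" for a b x y
    using seg[OF that(1,2), of "(x - a) / (b - a)"] that(3-5) by (simp add: divide_simps)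
  show "?P \<subseteq> octagon"
  proof
    fix v assume v: "v \<in> ?P"
    have xy: "v = vector [v $ 1, v $ 2]" by (simp add: vec_eq_iff forall_2)
    define x y where "x = v $ 1" and "y = v $ 2"
    have b: "0 \<le> x" "x \<le> 3" "0 \<le> y" "y \<le> 3" "1 \<le> x + y" "x + y \<le> 5" "x - y \<le> 2" "y - x \<le> 2"
      using v by (simp_all add: x_def y_def)
    consider "y \<le> 1" | "1 \<le> y" "y \<le> 2" | "2 \<le> y" by linarith
    then have "vector [x, y] \<in> octagon"
    proof cases
      case 1
      show ?thesis
        using row[of "1 - y" y "2 + y" x] seg[OF vertex(3,2), of y] seg[OF vertex(4,5), of y] 1 b
        by simp
    next
      case 2
      show ?thesis
        using row[of 0 y 3 x] seg[OF vertex(2,1), of "y - 1"] seg[OF vertex(5,6), of "y - 1"] 2 b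
        by simp
    next
      case 3
      show ?thesis
        using row[of "y - 2" y "5 - y" x] seg[OF vertex(1,8), of "y - 2"] seg[OF vertex(6,7), of "y - 2"] 3 b
        by simp
    qed
    then show "v \<in> octagon" using xy by (simp add: x_def y_def)
  qed
qed

lemma F_\<tau>: "F (\<tau> z) = vector [(cmod (z $ 1))\<^sup>2 / 2, (cmod (z $ 3))\<^sup>2 / 2]"
  by (simp add: F_def J_\<tau> H_\<tau>)

text \<open>
  The six equations of \<open>W\<close> express every \<open>\<bar>z\<^sub>k\<bar>\<^sup>2\<close> as an affine function of the values of
  \<open>J\<close> and \<open>H\<close>. The eight conditions \<open>\<bar>z\<^sub>k\<bar>\<^sup>2 \<ge> 0\<close> are then exactly the eight half-planes of
  the octagon, and square roots provide a preimage of each of its points.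
\<close>

lemma momentum_image: "F ` M = octagon"
proof
  show "F ` M \<subseteq> octagon"
  proof
    fix v assume "v \<in> F ` M"
    then obtain z where z: "z \<in> W" "v = F (\<tau> z)" by (auto simp: M_def)
    then show "v \<in> octagon"
      using z(1) zero_le_power2[of "cmod (z $ 1)"] zero_le_power2[of "cmod (z $ 2)"]
        zero_le_power2[of "cmod (z $ 3)"] zero_le_power2[of "cmod (z $ 4)"]
        zero_le_power2[of "cmod (z $ 5)"] zero_le_power2[of "cmod (z $ 6)"]
        zero_le_power2[of "cmod (z $ 7)"] zero_le_power2[of "cmod (z $ 8)"]
      unfolding octagon_eq W_def F_\<tau> mem_Collect_eq z(2) vector_2 by (elim conjE) (intro conjI; linarith)
  qed
  show "octagon \<subseteq> F ` M"
  proof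
    fix v assume v: "v \<in> octagon"
    define x y where "x = v $ 1" and "y = v $ 2"
    \<comment> \<open>the arguments of the roots are the values that the equations force on the squared moduli\<close>
    define z :: "complex ^ 8" where "z = vector (map (\<lambda>r. complex_of_real (sqrt r))
      [2 * x, 2 * x + 2 * y - 2, 2 * y, 4 - 2 * x + 2 * y, 6 - 2 * x, 10 - 2 * x - 2 * y, 6 - 2 * y,
       4 + 2 * x - 2 * y])"
    have "z \<in> W" using v by (simp add: W_def z_def vector_8 octagon_eq x_def y_def)
    moreover have "F (\<tau> z) = v"
      using v by (simp add: F_\<tau> z_def vector_8 octagon_eq x_def y_def vec_eq_iff forall_2)
    ultimately show "v \<in> F ` M" by (force simp: M_def)
  qed
qed

section \<open>The effective action of the two-torus\<close>

text \<open>
  The minus signs compensate the one in the momentum function of a rotation, so that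
  \<open>F\<close> itself is the momentum map.
\<close>

definition weights :: "real ^ 2 \<Rightarrow> real ^ 8" where
  "weights \<xi> = vector [- \<xi> $ 1, 0, - \<xi> $ 2, 0, 0, 0, 0, 0]"

lemma bounded_linear_weights: "bounded_linear weights"
  by (intro linear_conv_bounded_linear[THEN iffD1] linearI)
    (auto simp: weights_def vec_eq_iff forall_8 vector_8)

lemma F_eq_rot_momentum: "\<xi> \<bullet> F (\<tau> z) = rot_momentum (weights \<xi>) z"
  by (simp add: F_\<tau> rot_momentum_def weights_def sum_8 vector_8 inner_vec_def sum_2 power2_norm_eq_inner
      add_divide_distrib)

lemma weights_axis_integral: "\<exists>m::int. weights (axis i 1) $ k = of_int m"
proof -
  have "weights (axis i 1) $ k \<in> \<int>"
    using exhaust_8[of k] by (auto simp: weights_def vector_8 axis_def)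
  then show ?thesis by (auto elim: Ints_cases)
qed

text \<open>
  The point lies over the centre \<open>(3/2, 3/2)\<close> of the octagon, where no coordinate vanishes, so
  the phases of all eight coordinates can be compared. If a rotation acts on it like an element
  \<open>s\<close> of \<open>N\<close>, the coordinates 2, 4, 6, 8 make four of the components of \<open>s\<close> trivial, and then
  the coordinates 5 and 7 do so for the other two.
\<close>

lemma effective_at_center:
  fixes t :: "real ^ 2"
  defines "z \<equiv> vector [sqrt 3, 2, sqrt 3, 2, sqrt 3, 2, sqrt 3, 2] :: complex ^ 8"
  assumes "\<tau> (rot (weights t) z) = \<tau> z"
  shows "\<exists>m::int. t $ i = 2 * pi * of_int m"
proof -
  have "rot (weights t) z \<in> \<tau> z" using self_in_orbit assms(2) by blast
  then obtain s where s: "rot (weights t) z = N_act s z" by (auto simp: \<tau>_def)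
  have e: "cis (- t $ 1) = cis (s $ 1)" "cis (s $ 2) = 1" "cis (- t $ 2) = cis (s $ 3)" "cis (s $ 4) = 1"
    "cis (s $ 1 + s $ 2 - s $ 4 - s $ 5 + s $ 6) = 1" "cis (s $ 5) = 1"
    "cis (s $ 2 + s $ 3 + s $ 4 - s $ 5 - s $ 6) = 1" "cis (s $ 6) = 1"
    using s by (simp_all add: N_act_def z_def weights_def vec_eq_iff forall_8 vector_8)
  have "cis (- t $ 1) = 1" "cis (- t $ 2) = 1"
    using e by (simp_all add: cis_mult[symmetric] cis_divide[symmetric])
  then have "cis (- t $ i) = 1" using exhaust_2[of i] by auto
  then have "cos (t $ i) = 1" by (simp add: complex_eq_iff)
  then show ?thesis by (auto simp: cos_one_2pi_int mult.commute mult.left_commute)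
qed

lemma center_in_W: "(vector [sqrt 3, 2, sqrt 3, 2, sqrt 3, 2, sqrt 3, 2] :: complex ^ 8) \<in> W"
  by (simp add: W_def vector_8)

lemma (in octagon_manifold) hamiltonian_torus_action_weights:
  "hamiltonian_torus_action A \<omega> (\<lambda>t p. rot (weights t) ` p) F"
  unfolding hamiltonian_torus_action_def
proof (intro conjI)
  show "torus_action A (\<lambda>t p. rot (weights t) ` p)"
    by (rule torus_action_rot[OF bounded_linear_weights]) (auto simp: Basis_vec_def weights_axis_integral)
  show "symplectic_action A \<omega> (\<lambda>t p. rot (weights t) ` p)" by (rule symplectic_action_rot)
  show "momentum_map A \<omega> (\<lambda>t p. rot (weights t) ` p) F"
    unfolding momentum_map_def
  proof (intro conjI ballI allI)
    have "smooth_on W (\<lambda>z. (rot_momentum (weights (axis 1 1)) z, rot_momentum (weights (axis 2 1)) z))"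
      by (intro smooth_on_Pair smooth_on_rot_momentum)
    then have "smooth_on W (\<lambda>z. (\<lambda>(a, b). axis 1 a + axis 2 b :: real ^ 2)
        (rot_momentum (weights (axis 1 1)) z, rot_momentum (weights (axis 2 1)) z))"
      by (rule smooth_on_compose[OF _ smooth_on_linear[of _ UNIV]])
        (auto simp: case_prod_unfold intro!: bounded_linear_add
          bounded_linear_compose[OF bounded_linear_axis] bounded_linear_fst bounded_linear_snd)
    then have "smooth_on W (\<lambda>z. F (\<tau> z))"
      by (rule smooth_on_cong)
        (unfold F_eq_rot_momentum[symmetric] inner_axis', simp add: vec_eq_iff forall_2 axis_def)
    then show "smooth_map A (euclidean_atlas UNIV) F" by (simp add: smooth_map_iff)
    fix p assume p: "p \<in> atlas_carrier A"
    have w: "weights (s *\<^sub>R \<xi>) = s *\<^sub>R weights \<xi>" for s \<xi>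
      by (rule linear_cmul[OF bounded_linear.linear[OF bounded_linear_weights]])
    show "velocity A (\<lambda>s. rot (weights (s *\<^sub>R \<xi>)) ` p) \<in> tangent_space A p" for \<xi>
      unfolding w by (rule rot_hamiltonian(1)[OF F_eq_rot_momentum p])
    show "\<omega> p (velocity A (\<lambda>s. rot (weights (s *\<^sub>R \<xi>)) ` p)) Y = Y (\<lambda>q. \<xi> \<bullet> F q)"
      if "Y \<in> tangent_space A p" for \<xi> Y
      unfolding w by (rule rot_hamiltonian(2)[OF F_eq_rot_momentum p that])
    show "F (rot (weights t) ` p) = F p" for t
      using p by (auto simp: carrier_eq rot_image_orbit F_\<tau> norm_mult)
  qed
qed

lemma (in octagon_manifold) effective_weights: "effective A (\<lambda>t p. rot (weights t) ` p)"
  unfolding effective_def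
proof (intro allI impI ballI)
  fix t b :: "real ^ 2"
  assume "\<forall>p\<in>atlas_carrier A. rot (weights t) ` p = p" and "b \<in> Basis"
  then show "\<exists>m::int. t \<bullet> b = 2 * pi * of_int m"
    using effective_at_center[of t] center_in_W
    by (auto simp: carrier_eq rot_image_orbit Basis_vec_def inner_axis)
qed

theorem theorem3p6:
  fixes A :: "((complex ^ 8) set, real ^ 4) atlas"
    and \<omega> :: "(complex ^ 8) set two_form"
  assumes "compact_space M_top"
    and "symplectic_manifold M_top A \<omega>"
    and "smooth_submersion W A \<tau>"
    and "pullback_agrees W A \<tau> \<omega> omega_st"
  shows "(\<exists>\<rho> :: real ^ 2 \<Rightarrow> (complex ^ 8) set \<Rightarrow> (complex ^ 8) set.
            hamiltonian_torus_action A \<omega> \<rho> F \<and> effective A \<rho>) \<and>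
         F ` M = octagon \<and>
         (\<exists>\<rho>J. circle_action_of A \<omega> J \<rho>J \<and>
            (\<forall>t. \<forall>z\<in>W. \<rho>J t (\<tau> z) =
               \<tau> (vector [cis (- t) * z $ 1, z $ 2, z $ 3, z $ 4, z $ 5, z $ 6, z $ 7, z $ 8]))) \<and>
         (\<exists>\<rho>H. circle_action_of A \<omega> H \<rho>H \<and>
            (\<forall>t. \<forall>z\<in>W. \<rho>H t (\<tau> z) =
               \<tau> (vector [z $ 1, z $ 2, cis (- t) * z $ 3, z $ 4, z $ 5, z $ 6, z $ 7, z $ 8])))"
proof -
  interpret octagon_manifold A \<omega>
    using assms by unfold_locales (auto simp: symplectic_manifold_def M_top_def)
  have J: "J (\<tau> z) = rot_momentum (weights (axis 1 1)) z"
    and H: "H (\<tau> z) = rot_momentum (weights (axis 2 1)) z" for z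
    unfolding F_eq_rot_momentum[symmetric] by (simp_all add: F_def inner_axis')
  have rJ: "rot (t *\<^sub>R weights (axis 1 1)) ` \<tau> z =
      \<tau> (vector [cis (- t) * z $ 1, z $ 2, z $ 3, z $ 4, z $ 5, z $ 6, z $ 7, z $ 8])"
    and rH: "rot (t *\<^sub>R weights (axis 2 1)) ` \<tau> z =
      \<tau> (vector [z $ 1, z $ 2, cis (- t) * z $ 3, z $ 4, z $ 5, z $ 6, z $ 7, z $ 8])" for t z
    unfolding rot_image_orbit
    by (rule arg_cong[of _ _ \<tau>], simp add: vec_eq_iff forall_8 vector_8 weights_def axis_def)+
  show ?thesis
  proof (intro conjI exI allI ballI)
    show "hamiltonian_torus_action A \<omega> (\<lambda>t p. rot (weights t) ` p) F"
      by (rule hamiltonian_torus_action_weights)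
    show "effective A (\<lambda>t p. rot (weights t) ` p)" by (rule effective_weights)
    show "F ` M = octagon" by (rule momentum_image)
    show "circle_action_of A \<omega> J (\<lambda>t p. rot (t *\<^sub>R weights (axis 1 1)) ` p)"
      by (rule circle_action_rot[OF J weights_axis_integral])
    show "circle_action_of A \<omega> H (\<lambda>t p. rot (t *\<^sub>R weights (axis 2 1)) ` p)"
      by (rule circle_action_rot[OF H weights_axis_integral])
  qed (rule rJ rH)+
qed

end
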